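(* \textsc{EL-Multi-STC} admits a problem kernel with at most $(\tau+1)\cdot 2k_1$ vertices; that is, there is a polynomial-time algorithm that transforms any instance $(G,c,k,\Psi)$ of \textsc{EL-Multi-STC} into an equivalent instance of \textsc{EL-Multi-STC} whose graph has at most $(\tau+1)\cdot 2k_1$ vertices, where $\tau$ and $k_1$ are those of the input instance.
   Context: A $c$-labeling of $G=(V,E)$ is a partition $L=(S^1_L,\dots,S^c_L,W_L)$ of $E$ (strong classes $S^i_L$, weak class $W_L$); it is an STC-labeling if there are no edges $\{u,v\},\{v,w\}$ in a common $S^i_L$ with $\{u,w\}\notin E$. For $\Psi:E\to 2^{\{1,\dots,c\}}$, $L$ is $\Psi$-satisfying if each edge $e$ lies in $W_L$ or in $S^\alpha_L$ for some $\alpha\in\Psi(e)$. \textsc{EL-Multi-STC}: given $(G,c,k,\Psi)$, decide whether a $\Psi$-satisfying STC-labeling with $|W_L|\le k$ exists. $k_1=k_1(G)$ is the minimum number of weak edges in an STC-labeling of $G$ with one strong color ($c=1$, no lists). For an instance $(G,c,k,\Psi)$, $\tau:=|\Psi(E)\setminus\{\emptyset\}|$ is the number of distinct non-empty edge lists occurring in the instance. *)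

theory Defs
  imports "HOL-Library.Ramsey" "HOL-Library.Disjoint_Sets" "HOL-Library.Log_Nat"
    "HOL-Computational_Algebra.Polynomial"
begin

section \<open>The problem\<close>

text \<open>
  An undirected simple graph is given by a vertex set \<open>V\<close> and an edge set \<open>E \<subseteq> [V]\<^bsup>2\<^esup>\<close>.
  Only the values of \<open>S\<close> on the colours \<open>1, \<dots>, c\<close> matter; classes may be empty.
\<close>

definition labeling :: "'a set set \<Rightarrow> nat \<Rightarrow> (nat \<Rightarrow> 'a set set) \<Rightarrow> 'a set set \<Rightarrow> bool" where
  "labeling E c S W \<longleftrightarrow>
     (\<Union>i\<in>{1..c}. S i) \<union> W = E \<and>
     disjoint_family_on S {1..c} \<and>
     (\<forall>i\<in>{1..c}. S i \<inter> W = {})"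

text \<open>
  The condition \<open>u \<noteq> w\<close> makes the two edges distinct; without it \<open>{u, w}\<close> would be
  the singleton \<open>{u}\<close>, which is never an edge.
\<close>

definition stc_labeling :: "'a set set \<Rightarrow> nat \<Rightarrow> (nat \<Rightarrow> 'a set set) \<Rightarrow> 'a set set \<Rightarrow> bool" where
  "stc_labeling E c S W \<longleftrightarrow>
     labeling E c S W \<and>
     \<not> (\<exists>i\<in>{1..c}. \<exists>u v w. u \<noteq> w \<and> {u, v} \<in> S i \<and> {v, w} \<in> S i \<and> {u, w} \<notin> E)"

definition satisfies_lists ::
  "'a set set \<Rightarrow> ('a set \<Rightarrow> nat set) \<Rightarrow> (nat \<Rightarrow> 'a set set) \<Rightarrow> 'a set set \<Rightarrow> bool" where
  "satisfies_lists E \<Psi> S W \<longleftrightarrow> (\<forall>e\<in>E. e \<in> W \<or> (\<exists>\<alpha>\<in>\<Psi> e. e \<in> S \<alpha>))"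

definition k1 :: "'a set set \<Rightarrow> nat" where
  "k1 E = (LEAST m. \<exists>S W. stc_labeling E 1 S W \<and> card W = m)"

text \<open>
  The budget is an integer; an instance with negative budget is a no-instance.  This is what
  allows no-instances on very few vertices: with a nonnegative budget every instance on the empty
  graph is a yes-instance, whereas \<open>k1 E = 0\<close> does not force a yes-instance (a single edge with
  empty list and budget \<open>0\<close>).
\<close>

record el_instance =
  verts :: "nat set"
  edges :: "nat set set"
  colors :: nat
  budget :: int
  edge_lists :: "nat set \<Rightarrow> nat set"

definition wf_instance :: "el_instance \<Rightarrow> bool" where
  "wf_instance I \<longleftrightarrow>
     finite (verts I) \<and> edges I \<subseteq> nsets (verts I) 2 \<and>
     (\<forall>e\<in>edges I. edge_lists I e \<subseteq> {1..colors I})"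

definition el_multi_stc :: "el_instance \<Rightarrow> bool" where
  "el_multi_stc I \<longleftrightarrow>
     (\<exists>S W. stc_labeling (edges I) (colors I) S W \<and>
            satisfies_lists (edges I) (edge_lists I) S W \<and>
            int (card W) \<le> budget I)"

definition tau :: "el_instance \<Rightarrow> nat" where
  "tau I = card (edge_lists I ` edges I - {{}})"


section \<open>Polynomial-time computation\<close>

text \<open>
  The machine model is a first-order recursive language on binary trees whose leaves are natural
  numbers, with logarithmic cost: a number is measured by the length of its binary representation,
  and every evaluation step is charged the full size of the value it returns.  Hence every value
  occurring in a computation of cost \<open>t\<close>, in particular the output, has size at most \<open>t\<close>, unless
  it is part of the input; since each primitive operation takes polynomial time in the size of
  its arguments and its result, polynomial cost coincides with polynomial time on Turing machines.
\<close>

datatype val = Atom nat | Node val val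

fun val_size :: "val \<Rightarrow> nat" where
  "val_size (Atom n) = 1 + floorlog 2 n"
| "val_size (Node x y) = 1 + val_size x + val_size y"

datatype op1 = Fst | Snd | IsNode
datatype op2 = Pair_up | Plus | Minus | Equal

text \<open>Operations applied to a tree of the wrong shape treat it as, or return, \<open>Atom 0\<close>.\<close>

fun num :: "val \<Rightarrow> nat" where
  "num (Atom n) = n"
| "num (Node x y) = 0"

fun apply1 :: "op1 \<Rightarrow> val \<Rightarrow> val" where
  "apply1 Fst (Node x y) = x"
| "apply1 Fst (Atom n) = Atom 0"
| "apply1 Snd (Node x y) = y"
| "apply1 Snd (Atom n) = Atom 0"
| "apply1 IsNode (Node x y) = Atom 1"
| "apply1 IsNode (Atom n) = Atom 0"

fun apply2 :: "op2 \<Rightarrow> val \<Rightarrow> val \<Rightarrow> val" where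
  "apply2 Pair_up x y = Node x y"
| "apply2 Plus x y = Atom (num x + num y)"
| "apply2 Minus x y = Atom (num x - num y)"
| "apply2 Equal x y = Atom (if x = y then 1 else 0)"

text \<open>
  Variables are indices into the list of arguments of the function being evaluated, and a program
  is a list of function bodies, called by their position.  \<open>Cond\<close> takes the second branch
  exactly on \<open>Atom 0\<close>.
\<close>

datatype exp =
    Var nat
  | Const nat
  | Op1 op1 exp
  | Op2 op2 exp exp
  | Cond exp exp exp
  | Call nat "exp list"

type_synonym program = "exp list"

inductive eval :: "program \<Rightarrow> val list \<Rightarrow> exp \<Rightarrow> val \<Rightarrow> nat \<Rightarrow> bool"
  and evals :: "program \<Rightarrow> val list \<Rightarrow> exp list \<Rightarrow> val list \<Rightarrow> nat \<Rightarrow> bool"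
  for P :: program
where
  eval_Var: "i < length \<rho> \<Longrightarrow> eval P \<rho> (Var i) (\<rho> ! i) (val_size (\<rho> ! i))"
| eval_Const: "eval P \<rho> (Const n) (Atom n) (val_size (Atom n))"
| eval_Op1: "eval P \<rho> e x s \<Longrightarrow> v = apply1 f x \<Longrightarrow>
    eval P \<rho> (Op1 f e) v (s + val_size v)"
| eval_Op2: "eval P \<rho> e1 x s \<Longrightarrow> eval P \<rho> e2 y t \<Longrightarrow> v = apply2 f x y \<Longrightarrow>
    eval P \<rho> (Op2 f e1 e2) v (s + t + val_size v)"
| eval_Cond_true: "eval P \<rho> e x s \<Longrightarrow> x \<noteq> Atom 0 \<Longrightarrow> eval P \<rho> e1 v t \<Longrightarrow>
    eval P \<rho> (Cond e e1 e2) v (s + t + val_size v)"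
| eval_Cond_false: "eval P \<rho> e (Atom 0) s \<Longrightarrow> eval P \<rho> e2 v t \<Longrightarrow>
    eval P \<rho> (Cond e e1 e2) v (s + t + val_size v)"
| eval_Call: "i < length P \<Longrightarrow> evals P \<rho> es xs s \<Longrightarrow> eval P xs (P ! i) v t \<Longrightarrow>
    eval P \<rho> (Call i es) v (s + t + val_size v)"
| evals_Nil: "evals P \<rho> [] [] 0"
| evals_Cons: "eval P \<rho> e v s \<Longrightarrow> evals P \<rho> es vs t \<Longrightarrow>
    evals P \<rho> (e # es) (v # vs) (s + t)"

inductive_cases eval_VarE: "eval P \<rho> (Var i) v t"
inductive_cases eval_ConstE: "eval P \<rho> (Const n) v t"
inductive_cases eval_Op1E: "eval P \<rho> (Op1 f e) v t"
inductive_cases eval_Op2E: "eval P \<rho> (Op2 f e1 e2) v t"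
inductive_cases eval_CondE: "eval P \<rho> (Cond e e1 e2) v t"
inductive_cases eval_CallE: "eval P \<rho> (Call i es) v t"
inductive_cases evals_NilE: "evals P \<rho> [] vs t"
inductive_cases evals_ConsE: "evals P \<rho> (e # es) vs t"

lemma eval_deterministic:
  "eval P \<rho> e v t \<Longrightarrow> eval P \<rho> e v' t' \<Longrightarrow> v' = v \<and> t' = t"
  "evals P \<rho> es vs t \<Longrightarrow> evals P \<rho> es vs' t' \<Longrightarrow> vs' = vs \<and> t' = t"
proof (induction arbitrary: v' t' and vs' t' rule: eval_evals.inducts)
  case eval_Var
  then show ?case by (auto elim: eval_VarE)
next
  case eval_Const
  then show ?case by (auto elim: eval_ConstE)
next
  case eval_Op1
  from eval_Op1.prems show ?case
    by (rule eval_Op1E) (use eval_Op1 in blast)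
next
  case eval_Op2
  from eval_Op2.prems show ?case
    by (rule eval_Op2E) (use eval_Op2 in blast)
next
  case eval_Cond_true
  from eval_Cond_true.prems show ?case
    by (rule eval_CondE) (use eval_Cond_true in blast)+
next
  case eval_Cond_false
  from eval_Cond_false.prems show ?case
    by (rule eval_CondE) (use eval_Cond_false in blast)+
next
  case eval_Call
  from eval_Call.prems show ?case
    by (rule eval_CallE) (use eval_Call in blast)
next
  case evals_Nil
  then show ?case by (auto elim: evals_NilE)
next
  case evals_Cons
  from evals_Cons.prems show ?case
    by (rule evals_ConsE) (use evals_Cons in blast)
qed

definition runs :: "program \<Rightarrow> val \<Rightarrow> val \<Rightarrow> nat \<Rightarrow> bool" where
  "runs P x y t \<longleftrightarrow> eval P [x] (Call 0 [Var 0]) y t"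


section \<open>Encoding of instances\<close>

text \<open>
  Vertices are listed in increasing order, every edge \<open>{u, v}\<close> with \<open>u < v\<close> is listed once, in
  lexicographic order and together with its increasing list of colours.  All numbers,
  including \<open>colors\<close> and \<open>budget\<close>, are in binary.
\<close>

fun enc_list :: "val list \<Rightarrow> val" where
  "enc_list [] = Atom 0"
| "enc_list (x # xs) = Node x (enc_list xs)"

definition enc_int :: "int \<Rightarrow> val" where
  "enc_int k = Node (Atom (if k < 0 then 1 else 0)) (Atom (nat \<bar>k\<bar>))"

definition enc_set :: "nat set \<Rightarrow> val" where
  "enc_set A = enc_list (map Atom (sorted_list_of_set A))"

definition edge_list :: "el_instance \<Rightarrow> (nat \<times> nat) list" where
  "edge_list I =
     [(u, v). u \<leftarrow> sorted_list_of_set (verts I), v \<leftarrow> sorted_list_of_set (verts I),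
              u < v \<and> {u, v} \<in> edges I]"

definition encode :: "el_instance \<Rightarrow> val" where
  "encode I =
     Node (enc_set (verts I))
       (Node (enc_list (map (\<lambda>(u, v). Node (Atom u) (Node (Atom v) (enc_set (edge_lists I {u, v}))))
                         (edge_list I)))
         (Node (Atom (colors I)) (enc_int (budget I))))"

end

theory Submission
  imports Defs
begin

text \<open>
  Call a simplicial vertex \<open>v\<close> deletable if for every edge \<open>{v, x}\<close> with nonempty list, more edges
  with that list join \<open>x\<close> to the critical clique of \<open>v\<close> than edges join \<open>x\<close> to vertices outside the
  closed neighbourhood of \<open>v\<close>.  Then some optimal labeling makes all edges at \<open>v\<close> with nonempty
  lists strong, and \<open>v\<close> can be deleted while the budget is reduced by the number of edges at \<open>v\<close>
  with empty lists.  Once no vertex is deletable, fix a labeling with one colour and \<open>k\<^sub>1\<close> weak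
  edges.  At most \<open>2 k\<^sub>1\<close> vertices are incident with weak edges.  Every other vertex is simplicial and
  is charged to a pair of a vertex \<open>x\<close> and a nonempty list; each pair receives at most as many
  vertices as there are weak edges at \<open>x\<close>, that is, at most \<open>\<tau> \<cdot> 2 k\<^sub>1\<close> in total.
\<close>

section \<open>Closure properties of polynomial time\<close>

text \<open>The obstacle is that vertices of one critical clique need not be interchangeable: they
  have the same closed neighbourhood, but the lists on their edges to a common neighbour
  \<open>x\<close> may differ. They are therefore compared separately for each \<open>x\<close>, and
  only with those whose edge to \<open>x\<close> carries the same list. This is where the factor
  \<tau> comes from.

  The criterion is strict because \<open>v\<close> itself is among the vertices compared. After its
  deletion at least as many edges with the same list join \<open>x\<close> to the rest of the
  critical clique as join \<open>x\<close> to the outside, which is what an exchange of weak edges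
  at no cost needs. Conversely, a violated criterion bounds a whole group of equivalent vertices by
  the number of edges from \<open>x\<close> to the outside.

  The value \<open>k1\<close> and a labeling attaining it occur only in the analysis; the algorithm
  merely tests \<open>deletable\<close>. Since deletions lower the budget, it may become negative,
  and then the output is a no-instance.\<close>

abbreviation vfst :: "val \<Rightarrow> val" where "vfst \<equiv> apply1 Fst"
abbreviation vsnd :: "val \<Rightarrow> val" where "vsnd \<equiv> apply1 Snd"

fun elems :: "val \<Rightarrow> val list" where
  "elems (Atom n) = []"
| "elems (Node x y) = x # elems y"

lemma elems_enc_list [simp]: "elems (enc_list xs) = xs"
  by (induction xs) auto

lemma val_size_pos [simp]: "0 < val_size x"
  by (cases x) auto

lemma length_elems_le: "length (elems x) \<le> val_size x"
  by (induction x) auto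

lemma val_size_enc_list_filter: "val_size (enc_list (filter Q (elems x))) \<le> val_size x"
  by (induction x) (auto simp: floorlog_def)

text \<open>Every rule charges the size of the value it returns. A cost bound is therefore also a
  bound on the size of the result, from which \<open>ptime_size\<close> follows.\<close>

lemma val_size_le_cost: "eval P \<rho> e v t \<Longrightarrow> val_size v \<le> t"
  by (cases rule: eval.cases) auto

section \<open>Polynomial bounds and composition of programs\<close>

definition poly_bounded :: "(val \<Rightarrow> nat) \<Rightarrow> bool" where
  "poly_bounded T \<longleftrightarrow> (\<exists>p. \<forall>x. T x \<le> poly p (val_size x))"

lemma poly_nat_mono: "a \<le> b \<Longrightarrow> poly p a \<le> poly p (b :: nat)"
  by (induction p) (auto intro!: mult_mono add_mono)

lemma poly_bounded_const: "poly_bounded (\<lambda>_. c)"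
  unfolding poly_bounded_def by (rule exI[of _ "[:c:]"]) simp

lemma poly_bounded_size: "poly_bounded val_size"
  unfolding poly_bounded_def by (rule exI[of _ "[:0, 1:]"]) simp

lemma poly_bounded_add:
  assumes "poly_bounded S" "poly_bounded T"
  shows "poly_bounded (\<lambda>x. S x + T x)"
proof -
  obtain p q where "\<And>x. S x \<le> poly p (val_size x)" "\<And>x. T x \<le> poly q (val_size x)"
    using assms unfolding poly_bounded_def by blast
  then show ?thesis unfolding poly_bounded_def
    by (intro exI[of _ "p + q"]) (simp add: add_mono)
qed

lemma poly_bounded_mult:
  assumes "poly_bounded S" "poly_bounded T"
  shows "poly_bounded (\<lambda>x. S x * T x)"
proof -
  obtain p q where "\<And>x. S x \<le> poly p (val_size x)" "\<And>x. T x \<le> poly q (val_size x)"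
    using assms unfolding poly_bounded_def by blast
  then show ?thesis unfolding poly_bounded_def
    by (intro exI[of _ "p * q"]) (simp add: mult_mono)
qed

lemma poly_bounded_poly:
  assumes "poly_bounded T"
  shows "poly_bounded (\<lambda>x. poly p (T x))"
proof -
  obtain q where "\<And>x. T x \<le> poly q (val_size x)"
    using assms unfolding poly_bounded_def by blast
  then show ?thesis unfolding poly_bounded_def
    by (intro exI[of _ "pcompose p q"]) (simp add: poly_pcompose poly_nat_mono)
qed

lemma poly_bounded_mono: "poly_bounded T \<Longrightarrow> (\<And>x. S x \<le> T x) \<Longrightarrow> poly_bounded S"
  unfolding poly_bounded_def by (meson order_trans)

lemmas poly_bounded_intros =
  poly_bounded_const poly_bounded_size poly_bounded_add poly_bounded_mult poly_bounded_poly

text \<open>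
  The code \<open>Q\<close> of the auxiliary functions may be placed at any position \<open>n\<close> of a larger
  program, which is what makes this notion compositional.
\<close>

definition ptime :: "(val \<Rightarrow> val) \<Rightarrow> bool" where
  "ptime f \<longleftrightarrow> (\<forall>n. \<exists>Q e T. poly_bounded T \<and>
     (\<forall>P R x. length P = n \<longrightarrow> (\<exists>t\<le>T x. eval (P @ Q @ R) [x] e (f x) t)))"

abbreviation ptime_pred :: "(val \<Rightarrow> bool) \<Rightarrow> bool" where
  "ptime_pred b \<equiv> ptime (\<lambda>x. Atom (if b x then 1 else 0))"

lemma ptimeE:
  assumes "ptime f"
  obtains T Q e where "poly_bounded T"
    "\<And>P R x. length P = n \<Longrightarrow> \<exists>t\<le>T x. eval (P @ Q @ R) [x] e (f x) t"
  using assms unfolding ptime_def by metis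

lemma ptime_size:
  assumes "ptime f"
  shows "poly_bounded (\<lambda>x. val_size (f x))"
proof -
  obtain T Q e where "poly_bounded T"
    and "\<And>P R x. length P = 0 \<Longrightarrow> \<exists>t\<le>T x. eval (P @ Q @ R) [x] e (f x) t"
    using assms by (rule ptimeE[where n = 0]) (erule that, blast)
  then show ?thesis
    by (meson poly_bounded_mono val_size_le_cost le_trans list.size(3))
qed

lemma ptime_id: "ptime (\<lambda>x. x)"
  unfolding ptime_def
  by (intro allI exI[of _ "[]"] exI[of _ "Var 0"] exI[of _ val_size] conjI poly_bounded_size impI)
    (use eval_Var[of 0 "[_]"] in auto)

lemma ptime_Atom: "ptime (\<lambda>_. Atom n)"
  unfolding ptime_def
  by (intro allI exI[of _ "[]"] exI[of _ "Const n"] exI[of _ "\<lambda>_. val_size (Atom n)"] conjI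
        poly_bounded_const impI) (use eval_Const in blast)

lemma ptime_apply1:
  assumes f: "ptime f"
  shows "ptime (\<lambda>x. apply1 g (f x))"
  unfolding ptime_def
proof
  fix n
  obtain T Q e where T: "poly_bounded T"
    and e: "\<And>P R x. length P = n \<Longrightarrow> \<exists>t\<le>T x. eval (P @ Q @ R) [x] e (f x) t"
    using f by (rule ptimeE[where n = n]) (erule that, blast)
  have size: "val_size (apply1 g v) \<le> val_size v + 2" for v
    by (cases g; cases v) (auto simp: floorlog_def)
  show "\<exists>Q e T. poly_bounded T \<and>
     (\<forall>P R x. length P = n \<longrightarrow> (\<exists>t\<le>T x. eval (P @ Q @ R) [x] e (apply1 g (f x)) t))"
  proof (rule exI, rule exI, rule exI, intro conjI allI impI)
    show "poly_bounded (\<lambda>x. T x + (val_size (f x) + 2))"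
      by (intro poly_bounded_intros T ptime_size[OF f])
    fix P R :: program and x assume "length P = n"
    then obtain t where t: "t \<le> T x" "eval (P @ Q @ R) [x] e (f x) t" using e by blast
    show "\<exists>t\<le>T x + (val_size (f x) + 2). eval (P @ Q @ R) [x] (Op1 g e) (apply1 g (f x)) t"
      by (rule exI, rule conjI[rotated], rule eval_Op1[OF t(2) refl])
        (use add_mono[OF t(1) size[of "f x"]] in simp)
  qed
qed

text \<open>Composition becomes a call: the body \<open>e'\<close> of \<open>f\<close> sits at
  position \<open>n + length Q\<close>, between the auxiliary code of \<open>g\<close> and its own.
  Its cost is polynomial in the size of \<open>g x\<close>, which is polynomially bounded by
  \<open>ptime_size\<close>.\<close>

lemma ptime_comp:
  assumes f: "ptime f" and g: "ptime g"
  shows "ptime (\<lambda>x. f (g x))"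
  unfolding ptime_def
proof
  fix n
  obtain T Q e where T: "poly_bounded T"
    and e: "\<And>P R x. length P = n \<Longrightarrow> \<exists>t\<le>T x. eval (P @ Q @ R) [x] e (g x) t"
    using g by (rule ptimeE[where n = n]) (erule that, blast)
  obtain T' Q' e' where T': "poly_bounded T'"
    and e': "\<And>P R x. length P = Suc (n + length Q) \<Longrightarrow> \<exists>t\<le>T' x. eval (P @ Q' @ R) [x] e' (f x) t"
    using f by (rule ptimeE[where n = "Suc (n + length Q)"]) (erule that, blast)
  obtain p where p: "\<And>x. T' x \<le> poly p (val_size x)"
    using T' unfolding poly_bounded_def by blast
  have p_size: "poly_bounded (\<lambda>x. poly p (val_size (g x)))"
    by (intro poly_bounded_intros ptime_size g)
  then have "poly_bounded (\<lambda>x. T' (g x))" using p by (rule poly_bounded_mono)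
  moreover from this have "poly_bounded (\<lambda>x. val_size (f (g x)))"
  proof (rule poly_bounded_mono)
    fix x
    \<comment> \<open>The prefix is filler of the required length; only its length matters for the
      code of \<open>f\<close>.\<close>
    obtain t where "t \<le> T' (g x)" "eval (replicate (Suc (n + length Q)) e @ Q' @ []) [g x] e' (f (g x)) t"
      using e'[of "replicate (Suc (n + length Q)) e" "g x" "[]"] by auto
    then show "val_size (f (g x)) \<le> T' (g x)" using val_size_le_cost le_trans by blast
  qed
  ultimately have bounded: "poly_bounded (\<lambda>x. T x + T' (g x) + val_size (f (g x)))"
    by (intro poly_bounded_intros T)
  show "\<exists>Q e T. poly_bounded T \<and> (\<forall>P R x. length P = n \<longrightarrow>
     (\<exists>t\<le>T x. eval (P @ Q @ R) [x] e (f (g x)) t))"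
  proof (rule exI, rule exI, rule exI, intro conjI allI impI)
    show "poly_bounded (\<lambda>x. T x + T' (g x) + val_size (f (g x)))" by (rule bounded)
    fix P R :: program and x assume P: "length P = n"
    let ?P = "P @ (Q @ [e'] @ Q') @ R"
    obtain t where t: "t \<le> T x" "eval ?P [x] e (g x) t"
      using e[OF P, of x "[e'] @ Q' @ R"] by auto
    obtain t' where t': "t' \<le> T' (g x)" "eval ?P [g x] e' (f (g x)) t'"
      using e'[of "P @ Q @ [e']" "g x" R] P by auto
    have "eval ?P [x] (Call (n + length Q) [e]) (f (g x)) ((t + 0) + t' + val_size (f (g x)))"
      using P by (intro eval_Call[OF _ evals_Cons[OF t(2) evals_Nil]])
        (use t'(2) in \<open>simp_all add: nth_append\<close>)
    then show "\<exists>t\<le>T x + T' (g x) + val_size (f (g x)).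
        eval ?P [x] (Call (n + length Q) [e]) (f (g x)) t"
      using t(1) t'(1) by (intro exI[of _ "(t + 0) + t' + val_size (f (g x))"]) simp
  qed
qed

lemma floorlog_add: "floorlog 2 (m + n) \<le> floorlog 2 m + floorlog 2 n + 1"
proof -
  have "m < 2 ^ floorlog 2 m" "n < 2 ^ floorlog 2 n"
    using floorlog_bounds[of m 2] floorlog_bounds[of n 2]
    by (cases "m = 0"; cases "n = 0"; simp)+
  then have "m + n < 2 ^ floorlog 2 m * 2 ^ floorlog 2 n + 2 ^ floorlog 2 m * 2 ^ floorlog 2 n"
    by (intro add_less_le_mono)
      (metis One_nat_def leI less_le_trans mult.right_neutral mult_le_mono2 one_le_numeral
        one_le_power, metis less_imp_le_nat less_le_trans mult.left_neutral mult_le_mono1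
        one_le_numeral one_le_power)
  then have "m + n < 2 ^ (floorlog 2 m + floorlog 2 n + 1)" by (simp add: power_add)
  then show ?thesis by (intro floorlog_leI) auto
qed

lemma val_size_apply2: "val_size (apply2 g v w) \<le> val_size v + val_size w + 2"
proof -
  have num: "floorlog 2 (num v) + 1 \<le> val_size v" for v
    by (cases v) (auto simp: floorlog_def)
  show ?thesis
    using floorlog_add[of "num v" "num w"] num[of v] num[of w]
      floorlog_mono[of "num v - num w" "num v" 2]
    by (cases g) (auto simp: floorlog_def)
qed

lemma ptime_apply2:
  assumes f: "ptime f" and h: "ptime h"
  shows "ptime (\<lambda>x. apply2 g (f x) (h x))"
  unfolding ptime_def
proof
  fix n
  obtain T Q e where T: "poly_bounded T"
    and e: "\<And>P R x. length P = n \<Longrightarrow> \<exists>t\<le>T x. eval (P @ Q @ R) [x] e (f x) t"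
    using f by (rule ptimeE[where n = n]) (erule that, blast)
  obtain T' Q' e' where T': "poly_bounded T'"
    and e': "\<And>P R x. length P = n + length Q \<Longrightarrow> \<exists>t\<le>T' x. eval (P @ Q' @ R) [x] e' (h x) t"
    using h by (rule ptimeE[where n = "n + length Q"]) (erule that, blast)
  show "\<exists>Q e T. poly_bounded T \<and> (\<forall>P R x. length P = n \<longrightarrow>
     (\<exists>t\<le>T x. eval (P @ Q @ R) [x] e (apply2 g (f x) (h x)) t))"
  proof (rule exI[of _ "Q @ Q'"], rule exI[of _ "Op2 g e e'"],
      rule exI[of _ "\<lambda>x. T x + T' x + (val_size (f x) + val_size (h x) + 2)"], intro conjI allI impI)
    show "poly_bounded (\<lambda>x. T x + T' x + (val_size (f x) + val_size (h x) + 2))"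
      by (intro poly_bounded_intros T T' ptime_size f h)
    fix P R :: program and x assume P: "length P = n"
    obtain t where t: "t \<le> T x" "eval (P @ (Q @ Q') @ R) [x] e (f x) t"
      using e[OF P, of x "Q' @ R"] by auto
    obtain t' where t': "t' \<le> T' x" "eval (P @ (Q @ Q') @ R) [x] e' (h x) t'"
      using e'[of "P @ Q" x R] P by auto
    show "\<exists>t\<le>T x + T' x + (val_size (f x) + val_size (h x) + 2).
        eval (P @ (Q @ Q') @ R) [x] (Op2 g e e') (apply2 g (f x) (h x)) t"
      by (rule exI, rule conjI[rotated], rule eval_Op2[OF t(2) t'(2) refl])
        (use t(1) t'(1) val_size_apply2[of g "f x" "h x"] in linarith)
  qed
qed

lemma ptime_if:
  assumes b: "ptime_pred b" and f: "ptime f" and h: "ptime h"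
  shows "ptime (\<lambda>x. if b x then f x else h x)"
  unfolding ptime_def
proof
  fix n
  obtain T Q e where T: "poly_bounded T"
    and e: "\<And>P R x. length P = n \<Longrightarrow>
      \<exists>t\<le>T x. eval (P @ Q @ R) [x] e (Atom (if b x then 1 else 0)) t"
    using b by (rule ptimeE[where n = n]) (erule that, blast)
  obtain T1 Q1 e1 where T1: "poly_bounded T1"
    and e1: "\<And>P R x. length P = n + length Q \<Longrightarrow> \<exists>t\<le>T1 x. eval (P @ Q1 @ R) [x] e1 (f x) t"
    using f by (rule ptimeE[where n = "n + length Q"]) (erule that, blast)
  obtain T2 Q2 e2 where T2: "poly_bounded T2"
    and e2: "\<And>P R x. length P = n + length Q + length Q1 \<Longrightarrow>
      \<exists>t\<le>T2 x. eval (P @ Q2 @ R) [x] e2 (h x) t"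
    using h by (rule ptimeE[where n = "n + length Q + length Q1"]) (erule that, blast)
  show "\<exists>Q e T. poly_bounded T \<and> (\<forall>P R x. length P = n \<longrightarrow>
     (\<exists>t\<le>T x. eval (P @ Q @ R) [x] e (if b x then f x else h x) t))"
  proof (rule exI, rule exI, rule exI, intro conjI allI impI)
    show "poly_bounded (\<lambda>x. T x + (T1 x + T2 x) + (val_size (f x) + val_size (h x)))"
      by (intro poly_bounded_intros T T1 T2 ptime_size f h)
    fix P R :: program and x assume P: "length P = n"
    let ?P = "P @ (Q @ Q1 @ Q2) @ R"
    obtain t where t: "t \<le> T x" "eval ?P [x] e (Atom (if b x then 1 else 0)) t"
      using e[OF P, of x "Q1 @ Q2 @ R"] by auto
    obtain t1 where t1: "t1 \<le> T1 x" "eval ?P [x] e1 (f x) t1"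
      using e1[of "P @ Q" x "Q2 @ R"] P by auto
    obtain t2 where t2: "t2 \<le> T2 x" "eval ?P [x] e2 (h x) t2"
      using e2[of "P @ Q @ Q1" x R] P by auto
    show "\<exists>t\<le>T x + (T1 x + T2 x) + (val_size (f x) + val_size (h x)).
        eval ?P [x] (Cond e e1 e2) (if b x then f x else h x) t"
    proof (cases "b x")
      case True
      then have "eval ?P [x] (Cond e e1 e2) (f x) (t + t1 + val_size (f x))"
        using t(2) t1(2) by (intro eval_Cond_true) auto
      then show ?thesis using True t(1) t1(1)
        by (intro exI[of _ "t + t1 + val_size (f x)"]) simp
    next
      case False
      then have "eval ?P [x] (Cond e e1 e2) (h x) (t + t2 + val_size (h x))"
        using t(2) t2(2) by (intro eval_Cond_false) auto
      then show ?thesis using False t(1) t2(1)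
        by (intro exI[of _ "t + t2 + val_size (h x)"]) simp
    qed
  qed
qed

section \<open>Loops over lists\<close>

text \<open>One iteration may add \<open>val_size y + 2\<close>, which is at most twice what the
  cell holding \<open>y\<close> contributes to \<open>val_size L\<close>.\<close>

lemma val_size_foldr:
  assumes "\<And>y b. val_size (f y b) \<le> val_size b + val_size y + 2"
  shows "val_size (foldr f (elems L) a) \<le> val_size a + 2 * val_size L"
proof (induction L)
  case (Node y L)
  have "val_size (foldr f (elems (Node y L)) a) \<le> val_size (foldr f (elems L) a) + val_size y + 2"
    using assms by simp
  moreover have "0 < val_size y" by simp
  ultimately show ?case using Node.IH(2) by (simp del: val_size_pos)
qed simp

text \<open>
  The code expects the body of the loop, applied to the triple of environment, list element and
  accumulator, at the next position of the program.
\<close>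

definition foldr_code :: "nat \<Rightarrow> exp" where
  "foldr_code m = Cond (Op1 IsNode (Var 1))
     (Call (Suc m) [Op2 Pair_up (Var 0)
        (Op2 Pair_up (Op1 Fst (Var 1)) (Call m [Var 0, Op1 Snd (Var 1), Var 2]))]) (Var 2)"

text \<open>Environment and initial value stay fixed and the list only shrinks in recursive calls,
  so one \<open>D\<close> serves for all suffixes and the cost is the number of calls times a
  uniform bound. There \<open>4 * D + 4\<close> covers the triple passed to the body, and
  \<open>30 * D + 30\<close> is a generous allowance for the evaluation of the surrounding
  expression.\<close>

lemma eval_foldr_code:
  fixes f :: "val \<Rightarrow> val \<Rightarrow> val"
  assumes m: "Suc m < length P" and F: "P ! m = foldr_code m"
    and body: "\<And>y b. \<exists>t\<le>poly p (val_size (Node x (Node y b))).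
          eval P [Node x (Node y b)] (P ! Suc m) (f y b) t"
    and growth: "\<And>y b. val_size (f y b) \<le> val_size b + val_size y + 2"
    and D: "val_size x + val_size L + val_size a \<le> D"
  shows "\<exists>t\<le>Suc (length (elems L)) * (30 * D + 30 + poly p (4 * D + 4)).
    eval P [x, L, a] (foldr_code m) (foldr f (elems L) a) t"
  using D
proof (induction L)
  case (Atom k)
  have 1: "eval P [x, Atom k, a] (Op1 IsNode (Var 1)) (Atom 0) (val_size (Atom k) + val_size (Atom 0))"
    using eval_Var[of 1 "[x, Atom k, a]" P] by (intro eval_Op1) auto
  have 2: "eval P [x, Atom k, a] (Var 2) a (val_size a)"
    using eval_Var[of 2 "[x, Atom k, a]" P] by simp
  have "eval P [x, Atom k, a] (foldr_code m) a (val_size (Atom k) + val_size (Atom 0) + val_size a + val_size a)"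
    unfolding foldr_code_def by (rule eval_Cond_false[OF 1 2])
  moreover have "val_size (Atom k) + val_size (Atom 0) + val_size a + val_size a
     \<le> Suc (length (elems (Atom k))) * (30 * D + 30 + poly p (4 * D + 4))"
    using Atom by (simp add: floorlog_def)
  ultimately show ?case by (auto simp del: mult_Suc)
next
  case (Node y L)
  let ?L = "Node y L" and ?C = "30 * D + 30 + poly p (4 * D + 4)"
  let ?\<rho> = "[x, ?L, a]" and ?r = "foldr f (elems L) a"
  have v: "eval P ?\<rho> (Var 0) x (val_size x)" "eval P ?\<rho> (Var 1) ?L (val_size ?L)"
      "eval P ?\<rho> (Var 2) a (val_size a)"
    using eval_Var[of 0 ?\<rho> P] eval_Var[of 1 ?\<rho> P] eval_Var[of 2 ?\<rho> P] by simp_all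
  have "val_size x + val_size L + val_size a \<le> D" using Node.prems by simp
  from Node.IH(2)[OF this] obtain t where
    t: "t \<le> Suc (length (elems L)) * ?C" "eval P [x, L, a] (foldr_code m) ?r t" by blast
  obtain t' where t': "t' \<le> poly p (val_size (Node x (Node y ?r)))"
     "eval P [Node x (Node y ?r)] (P ! Suc m) (f y ?r) t'" using body by blast
  have r: "val_size ?r \<le> val_size a + 2 * val_size L"
    using growth by (rule val_size_foldr)
  have fr: "val_size (f y ?r) \<le> val_size ?r + val_size y + 2"
    by (rule growth)
  have node: "eval P ?\<rho> (Op1 IsNode (Var 1)) (Atom 1) (val_size ?L + val_size (Atom 1))"
    using v(2) by (intro eval_Op1) auto
  have fst: "eval P ?\<rho> (Op1 Fst (Var 1)) y (val_size ?L + val_size y)"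
    using v(2) by (intro eval_Op1) auto
  have snd: "eval P ?\<rho> (Op1 Snd (Var 1)) L (val_size ?L + val_size L)"
    using v(2) by (intro eval_Op1) auto
  have rec: "eval P ?\<rho> (Call m [Var 0, Op1 Snd (Var 1), Var 2]) ?r
      ((val_size x + ((val_size ?L + val_size L) + (val_size a + 0))) + t + val_size ?r)"
    using m by (intro eval_Call[OF _ evals_Cons[OF v(1) evals_Cons[OF snd evals_Cons[OF v(3) evals_Nil]]]])
      (simp_all add: F t(2))
  define s where "s = (val_size x + ((val_size ?L + val_size L) + (val_size a + 0))) + t + val_size ?r"
  have pair: "eval P ?\<rho> (Op2 Pair_up (Var 0)
        (Op2 Pair_up (Op1 Fst (Var 1)) (Call m [Var 0, Op1 Snd (Var 1), Var 2])))
      (Node x (Node y ?r))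
      (val_size x + ((val_size ?L + val_size y) + s + val_size (Node y ?r))
        + val_size (Node x (Node y ?r)))"
    by (rule eval_Op2[OF v(1) eval_Op2[OF fst rec[folded s_def]]]) simp_all
  define s' where "s' = val_size x + ((val_size ?L + val_size y) + s + val_size (Node y ?r))
        + val_size (Node x (Node y ?r))"
  have call: "eval P ?\<rho> (Call (Suc m) [Op2 Pair_up (Var 0)
        (Op2 Pair_up (Op1 Fst (Var 1)) (Call m [Var 0, Op1 Snd (Var 1), Var 2]))])
      (f y ?r) ((s' + 0) + t' + val_size (f y ?r))"
    by (rule eval_Call[OF m evals_Cons[OF pair[folded s'_def] evals_Nil] t'(2)])
  have "eval P ?\<rho> (foldr_code m) (f y ?r) ((val_size ?L + val_size (Atom 1)) +
      ((s' + 0) + t' + val_size (f y ?r)) + val_size (f y ?r))"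
    unfolding foldr_code_def by (rule eval_Cond_true[OF node _ call]) simp
  moreover have "(val_size ?L + val_size (Atom 1)) +
      ((s' + 0) + t' + val_size (f y ?r)) + val_size (f y ?r)
     \<le> Suc (length (elems ?L)) * ?C"
  proof -
    have "val_size (Node x (Node y ?r)) \<le> 4 * D + 4"
      using r Node.prems by simp
    then have "t' \<le> poly p (4 * D + 4)" using t'(1) poly_nat_mono le_trans by blast
    moreover have "val_size (Atom 1) = 2" by (simp add: floorlog_def)
    ultimately have "(val_size ?L + val_size (Atom 1)) +
      ((s' + 0) + t' + val_size (f y ?r)) + val_size (f y ?r) \<le> t + ?C"
      using r fr Node.prems unfolding s'_def s_def by simp
    then show ?thesis using t(1) by simp
  qed
  ultimately show ?case by (auto simp del: mult_Suc)
qed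

text \<open>
  The growth condition keeps all accumulators linear in the sizes of the list and of the initial
  value; without it, iterating a polynomial-time body could take exponential time.
\<close>

lemma ptime_foldr:
  assumes f: "ptime (\<lambda>z. f (vfst z) (vfst (vsnd z)) (vsnd (vsnd z)))"
    and l: "ptime l" and a: "ptime a"
    and growth: "\<And>x y b. val_size (f x y b) \<le> val_size b + val_size y + 2"
  shows "ptime (\<lambda>x. foldr (f x) (elems (l x)) (a x))"
  unfolding ptime_def
proof
  fix n
  obtain T1 Q1 e1 where T1: "poly_bounded T1"
    and e1: "\<And>P R x. length P = n \<Longrightarrow> \<exists>t\<le>T1 x. eval (P @ Q1 @ R) [x] e1 (l x) t"
    using l by (rule ptimeE[where n = n]) (erule that, blast)
  obtain T2 Q2 e2 where T2: "poly_bounded T2"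
    and e2: "\<And>P R x. length P = n + length Q1 \<Longrightarrow> \<exists>t\<le>T2 x. eval (P @ Q2 @ R) [x] e2 (a x) t"
    using a by (rule ptimeE[where n = "n + length Q1"]) (erule that, blast)
  define m where "m = n + length Q1 + length Q2"
  obtain T Q e where T: "poly_bounded T"
    and e: "\<And>P R z. length P = Suc (Suc m) \<Longrightarrow>
      \<exists>t\<le>T z. eval (P @ Q @ R) [z] e (f (vfst z) (vfst (vsnd z)) (vsnd (vsnd z))) t"
    using f by (rule ptimeE[where n = "Suc (Suc m)"]) (erule that, blast)
  obtain p where p: "\<And>z. T z \<le> poly p (val_size z)"
    using T unfolding poly_bounded_def by blast
  define D where "D x = val_size x + val_size (l x) + val_size (a x)" for x
  define B where "B x = val_size x + T1 x + T2 x
     + Suc (val_size (l x)) * (30 * D x + 30 + poly p (4 * D x + 4))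
     + (val_size (a x) + 2 * val_size (l x))" for x
  show "\<exists>Q e T. poly_bounded T \<and> (\<forall>P R x. length P = n \<longrightarrow>
     (\<exists>t\<le>T x. eval (P @ Q @ R) [x] e (foldr (f x) (elems (l x)) (a x)) t))"
  proof (rule exI, rule exI, rule exI, intro conjI allI impI)
    show "poly_bounded B"
      unfolding B_def D_def Suc_eq_plus1
      by (intro poly_bounded_intros T1 T2 ptime_size l a)
    fix P R :: program and x assume P: "length P = n"
    let ?P = "P @ (Q1 @ Q2 @ [foldr_code m, e] @ Q) @ R"
    obtain t1 where t1: "t1 \<le> T1 x" "eval ?P [x] e1 (l x) t1"
      using e1[OF P, of x "Q2 @ [foldr_code m, e] @ Q @ R"] by auto
    obtain t2 where t2: "t2 \<le> T2 x" "eval ?P [x] e2 (a x) t2"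
      using e2[of "P @ Q1" x "[foldr_code m, e] @ Q @ R"] P by auto
    have m: "Suc m < length ?P" "?P ! m = foldr_code m" "?P ! Suc m = e"
      using P by (simp_all add: m_def nth_append)
    have "\<exists>t\<le>poly p (val_size (Node x (Node y b))). eval ?P [Node x (Node y b)] (?P ! Suc m) (f x y b) t"
      for y b
    proof -
      obtain t where "t \<le> T (Node x (Node y b))" "eval ?P [Node x (Node y b)] e (f x y b) t"
        using e[of "P @ Q1 @ Q2 @ [foldr_code m, e]" "Node x (Node y b)" R] P by (auto simp: m_def)
      then show ?thesis using p[of "Node x (Node y b)"] unfolding m(3) by (meson order_trans)
    qed
    from eval_foldr_code[OF m(1,2) this, of "l x" "a x" "D x"] growth
    obtain t where t: "t \<le> Suc (length (elems (l x))) * (30 * D x + 30 + poly p (4 * D x + 4))"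
      "eval ?P [x, l x, a x] (foldr_code m) (foldr (f x) (elems (l x)) (a x)) t"
      unfolding D_def by auto
    have "eval ?P [x] (Call m [Var 0, e1, e2]) (foldr (f x) (elems (l x)) (a x))
       ((val_size x + (t1 + (t2 + 0))) + t + val_size (foldr (f x) (elems (l x)) (a x)))"
      using m(1,2) t(2) t1(2) t2(2) eval_Var[of 0 "[x]" ?P]
      by (intro eval_Call[OF _ evals_Cons[OF _ evals_Cons[OF _ evals_Cons[OF _ evals_Nil]]]])
        (simp_all del: append_assoc)
    moreover have "Suc (length (elems (l x))) * (30 * D x + 30 + poly p (4 * D x + 4))
      \<le> Suc (val_size (l x)) * (30 * D x + 30 + poly p (4 * D x + 4))"
      using length_elems_le by (intro mult_le_mono1) simp
    then have "(val_size x + (t1 + (t2 + 0))) + t + val_size (foldr (f x) (elems (l x)) (a x)) \<le> B x"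
      using t(1) t1(1) t2(1) val_size_foldr[of "f x" "l x" "a x", OF growth]
      unfolding B_def by linarith
    ultimately show "\<exists>t\<le>B x. eval ?P [x] (Call m [Var 0, e1, e2]) (foldr (f x) (elems (l x)) (a x)) t"
      by blast
  qed
qed

section \<open>Arithmetic, Boolean and list operations\<close>

lemma ptime_Node: "ptime f \<Longrightarrow> ptime g \<Longrightarrow> ptime (\<lambda>x. Node (f x) (g x))"
  using ptime_apply2[where g = Pair_up] by simp

lemma ptime_plus:
  "ptime (\<lambda>x. Atom (f x)) \<Longrightarrow> ptime (\<lambda>x. Atom (g x)) \<Longrightarrow> ptime (\<lambda>x. Atom (f x + g x))"
  using ptime_apply2[where g = Plus and f = "\<lambda>x. Atom (f x)" and h = "\<lambda>x. Atom (g x)"] by simp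

lemma ptime_minus:
  "ptime (\<lambda>x. Atom (f x)) \<Longrightarrow> ptime (\<lambda>x. Atom (g x)) \<Longrightarrow> ptime (\<lambda>x. Atom (f x - g x))"
  using ptime_apply2[where g = Minus and f = "\<lambda>x. Atom (f x)" and h = "\<lambda>x. Atom (g x)"] by simp

lemma ptime_num: "ptime f \<Longrightarrow> ptime (\<lambda>x. Atom (num (f x)))"
  using ptime_apply2[where g = Plus and f = f and h = "\<lambda>_. Atom 0"] ptime_Atom by simp

lemma ptime_eq: "ptime f \<Longrightarrow> ptime g \<Longrightarrow> ptime_pred (\<lambda>x. f x = g x)"
  using ptime_apply2[where g = Equal] by simp

lemma ptime_not:
  assumes "ptime_pred b"
  shows "ptime_pred (\<lambda>x. \<not> b x)"
proof -
  have "(\<lambda>x. Atom (if Atom (if b x then 1 else 0) = Atom 0 then 1 else 0)) =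
     (\<lambda>x. Atom (if \<not> b x then 1 else 0))" by auto
  then show ?thesis using ptime_eq[OF assms ptime_Atom, of 0] by simp
qed

lemma ptime_conj:
  assumes "ptime_pred b" "ptime_pred c"
  shows "ptime_pred (\<lambda>x. b x \<and> c x)"
proof -
  have "(\<lambda>x. Atom (if b x \<and> c x then 1 else 0)) =
     (\<lambda>x. if b x then Atom (if c x then 1 else 0) else Atom 0)" by auto
  then show ?thesis using ptime_if[OF assms ptime_Atom, of 0] by simp
qed

lemma ptime_disj:
  assumes "ptime_pred b" "ptime_pred c"
  shows "ptime_pred (\<lambda>x. b x \<or> c x)"
  using ptime_not[OF ptime_conj[OF ptime_not ptime_not], OF assms] by simp

lemma ptime_less:
  assumes "ptime (\<lambda>x. Atom (f x))" "ptime (\<lambda>x. Atom (g x))"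
  shows "ptime_pred (\<lambda>x. f x < g x)"
  using ptime_not[OF ptime_eq[OF ptime_minus[OF assms(2,1)] ptime_Atom], of 0] by (simp add: not_le)

lemma ptime_Bex:
  assumes b: "ptime_pred (\<lambda>z. b (vfst z) (vfst (vsnd z)))" and l: "ptime l"
  shows "ptime_pred (\<lambda>x. \<exists>y\<in>set (elems (l x)). b x y)"
proof -
  have "Atom (if \<exists>y\<in>set ys. b x y then 1 else 0) =
      foldr (\<lambda>y r. if b x y then Atom 1 else r) ys (Atom 0)" for x ys
    by (induction ys) auto
  moreover have "ptime (\<lambda>x. foldr (\<lambda>y r. if b x y then Atom 1 else r) (elems (l x)) (Atom 0))"
    by (intro ptime_foldr ptime_if b ptime_Atom ptime_apply1 ptime_id l) (auto simp: floorlog_def)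
  ultimately show ?thesis by simp
qed

lemma ptime_Ball:
  assumes "ptime_pred (\<lambda>z. b (vfst z) (vfst (vsnd z)))" "ptime l"
  shows "ptime_pred (\<lambda>x. \<forall>y\<in>set (elems (l x)). b x y)"
  using ptime_not[OF ptime_Bex[OF ptime_not], of b, OF assms] by simp

lemma ptime_filter:
  assumes b: "ptime_pred (\<lambda>z. b (vfst z) (vfst (vsnd z)))" and l: "ptime l"
  shows "ptime (\<lambda>x. enc_list (filter (\<lambda>y. b x y) (elems (l x))))"
proof -
  have "enc_list (filter (\<lambda>y. b x y) ys) = foldr (\<lambda>y r. if b x y then Node y r else r) ys (Atom 0)"
    for x ys by (induction ys) auto
  moreover have "ptime (\<lambda>x. foldr (\<lambda>y r. if b x y then Node y r else r) (elems (l x)) (Atom 0))"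
    by (intro ptime_foldr ptime_if b ptime_Atom ptime_apply1 ptime_id ptime_Node l) auto
  ultimately show ?thesis by simp
qed

lemma ptime_count:
  assumes b: "ptime_pred (\<lambda>z. b (vfst z) (vfst (vsnd z)))" and l: "ptime l"
  shows "ptime (\<lambda>x. Atom (length (filter (\<lambda>y. b x y) (elems (l x)))))"
proof -
  have "Atom (length (filter (\<lambda>y. b x y) ys)) =
      foldr (\<lambda>y r. if b x y then Atom (num r + 1) else r) ys (Atom 0)" for x ys
  proof (induction ys)
    case (Cons y ys)
    then show ?case by (simp flip: Cons.IH)
  qed simp
  moreover have "val_size (Atom (num r + 1)) \<le> val_size r + val_size y + 2" for r y
    using floorlog_add[of "num r" 1] by (cases r) (auto simp: floorlog_def)
  then have "ptime (\<lambda>x. foldr (\<lambda>y r. if b x y then Atom (num r + 1) else r) (elems (l x)) (Atom 0))"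
    by (intro ptime_foldr ptime_if b ptime_Atom ptime_apply1 ptime_id ptime_plus ptime_num l) auto
  ultimately show ?thesis by simp
qed

lemmas ptime_intros = ptime_id ptime_Atom ptime_apply1 ptime_Node ptime_plus ptime_minus ptime_num
  ptime_eq ptime_not ptime_conj ptime_disj ptime_less ptime_Bex ptime_Ball ptime_filter ptime_count
  ptime_if

text \<open>A run starts with \<open>Call 0\<close>, so the main expression occupies position 0 and
  its auxiliary code is generated for position 1.\<close>

lemma ptime_runs:
  assumes "ptime f"
  shows "\<exists>P p. \<forall>x. \<exists>t\<le>poly p (val_size x). runs P x (f x) t"
proof -
  obtain T Q e where T: "poly_bounded T"
    and e: "\<And>P R x. length P = 1 \<Longrightarrow> \<exists>t\<le>T x. eval (P @ Q @ R) [x] e (f x) t"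
    using assms by (rule ptimeE[where n = 1]) (erule that, blast)
  have "poly_bounded (\<lambda>x. val_size x + T x + val_size (f x))"
    by (intro poly_bounded_intros T ptime_size assms)
  then obtain p where p: "\<And>x. val_size x + T x + val_size (f x) \<le> poly p (val_size x)"
    unfolding poly_bounded_def by blast
  have "\<exists>t\<le>poly p (val_size x). runs ([e] @ Q) x (f x) t" for x
  proof -
    obtain t where t: "t \<le> T x" "eval ([e] @ Q) [x] e (f x) t"
      using e[of "[e]" x "[]"] by auto
    have "eval ([e] @ Q) [x] (Call 0 [Var 0]) (f x) ((val_size x + 0) + t + val_size (f x))"
      using t(2) eval_Var[of 0 "[x]" "[e] @ Q"]
      by (intro eval_Call[OF _ evals_Cons[OF _ evals_Nil]]) auto
    moreover have "(val_size x + 0) + t + val_size (f x) \<le> poly p (val_size x)"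
      using p[of x] t(1) by simp
    ultimately show ?thesis unfolding runs_def by blast
  qed
  then show ?thesis by blast
qed

section \<open>Deletable vertices\<close>

text \<open>
  A labeling is represented by a single colouring of the edges, in which colour \<open>0\<close> means weak.
\<close>

definition stc_coloring :: "'a set set \<Rightarrow> ('a set \<Rightarrow> nat set) \<Rightarrow> ('a set \<Rightarrow> nat) \<Rightarrow> bool" where
  "stc_coloring E \<Psi> f \<longleftrightarrow> (\<forall>e\<in>E. f e = 0 \<or> f e \<in> \<Psi> e) \<and>
     (\<forall>u v w. u \<noteq> w \<longrightarrow> {u, v} \<in> E \<longrightarrow> {v, w} \<in> E \<longrightarrow> {u, w} \<notin> E \<longrightarrow> f {u, v} \<noteq> 0 \<longrightarrow>
        f {u, v} \<noteq> f {v, w})"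

definition weak_edges :: "'a set set \<Rightarrow> ('a set \<Rightarrow> nat) \<Rightarrow> 'a set set" where
  "weak_edges E f = {e \<in> E. f e = 0}"

lemma stc_labeling_imp_stc_coloring:
  assumes L: "stc_labeling E c S W" "satisfies_lists E \<Psi> S W"
    and \<Psi>: "\<forall>e\<in>E. \<Psi> e \<subseteq> {1..c}"
  obtains f where "stc_coloring E \<Psi> f" "weak_edges E f = W"
proof
  define f where "f e = (if \<exists>i\<in>{1..c}. e \<in> S i then THE i. i \<in> {1..c} \<and> e \<in> S i else 0)" for e
  have U: "(\<Union>i\<in>{1..c}. S i) \<union> W = E" and D: "disjoint_family_on S {1..c}"
    and SW: "\<forall>i\<in>{1..c}. S i \<inter> W = {}"
    using L(1) unfolding stc_labeling_def labeling_def by auto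
  have f: "f e = i" if "i \<in> {1..c}" "e \<in> S i" for e i
  proof -
    have "(THE i. i \<in> {1..c} \<and> e \<in> S i) = i"
      using that D unfolding disjoint_family_on_def by (intro the_equality) blast+
    then show ?thesis using that unfolding f_def by auto
  qed
  have f0: "f e = 0" if "\<not> (\<exists>i\<in>{1..c}. e \<in> S i)" for e using that unfolding f_def by auto
  have fS: "f e \<in> {1..c} \<and> e \<in> S (f e)" if "f e \<noteq> 0" for e using f f0 that by metis
  show "weak_edges E f = W"
  proof
    show "weak_edges E f \<subseteq> W" using f U unfolding weak_edges_def by fastforce
    show "W \<subseteq> weak_edges E f" using fS SW U unfolding weak_edges_def by blast
  qed
  show "stc_coloring E \<Psi> f"
    unfolding stc_coloring_def
  proof (intro conjI ballI allI impI notI)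
    fix e assume e: "e \<in> E"
    show "f e = 0 \<or> f e \<in> \<Psi> e"
    proof (cases "e \<in> W")
      case True
      then show ?thesis using fS SW by blast
    next
      case False
      then obtain \<alpha> where "\<alpha> \<in> \<Psi> e" "e \<in> S \<alpha>" using L(2) e unfolding satisfies_lists_def by blast
      then show ?thesis using f \<Psi> e by blast
    qed
  next
    fix u v w assume *: "u \<noteq> w" "{u, w} \<notin> E" "f {u, v} \<noteq> 0" "f {u, v} = f {v, w}"
    then have "{u, v} \<in> S (f {u, v})" "{v, w} \<in> S (f {u, v})" "f {u, v} \<in> {1..c}"
      using fS[of "{u, v}"] fS[of "{v, w}"] by auto
    then show False using L(1) * unfolding stc_labeling_def by blast
  qed
qed

lemma stc_coloring_imp_stc_labeling:
  assumes f: "stc_coloring E \<Psi> f" and \<Psi>: "\<forall>e\<in>E. \<Psi> e \<subseteq> {1..c}"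
  obtains S where "stc_labeling E c S (weak_edges E f)" "satisfies_lists E \<Psi> S (weak_edges E f)"
proof
  define S where "S i = {e \<in> E. f e = i}" for i
  have range: "f e = 0 \<or> f e \<in> {1..c} \<and> f e \<in> \<Psi> e" if "e \<in> E" for e
    using f \<Psi> that unfolding stc_coloring_def by blast
  have "\<not> (\<exists>i\<in>{1..c}. \<exists>u v w. u \<noteq> w \<and> {u, v} \<in> S i \<and> {v, w} \<in> S i \<and> {u, w} \<notin> E)"
  proof
    assume "\<exists>i\<in>{1..c}. \<exists>u v w. u \<noteq> w \<and> {u, v} \<in> S i \<and> {v, w} \<in> S i \<and> {u, w} \<notin> E"
    then obtain i u v w where "i \<in> {1..c}" "u \<noteq> w" "{u, v} \<in> S i" "{v, w} \<in> S i" "{u, w} \<notin> E"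
      by blast
    then show False using f unfolding stc_coloring_def S_def by fastforce
  qed
  then show "stc_labeling E c S (weak_edges E f)"
    using range unfolding stc_labeling_def labeling_def S_def weak_edges_def disjoint_family_on_def
    by fastforce
  show "satisfies_lists E \<Psi> S (weak_edges E f)"
    using range unfolding satisfies_lists_def S_def weak_edges_def by auto
qed

lemma el_multi_stc_iff:
  assumes "wf_instance I"
  shows "el_multi_stc I \<longleftrightarrow> (\<exists>f. stc_coloring (edges I) (edge_lists I) f \<and>
    int (card (weak_edges (edges I) f)) \<le> budget I)"
proof -
  have \<Psi>: "\<forall>e\<in>edges I. edge_lists I e \<subseteq> {1..colors I}"
    using assms unfolding wf_instance_def by auto
  show ?thesis
    unfolding el_multi_stc_def
    by (metis stc_labeling_imp_stc_coloring[OF _ _ \<Psi>] stc_coloring_imp_stc_labeling[OF _ \<Psi>])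
qed

text \<open>With a single colour the list \<open>{1}\<close> on every edge is no restriction, so
  \<open>k1\<close> is a minimum over colourings with these lists.\<close>

lemma k1_le:
  assumes "stc_coloring E (\<lambda>_. {1}) f"
  shows "k1 E \<le> card (weak_edges E f)"
proof -
  obtain S where "stc_labeling E 1 S (weak_edges E f)"
    using stc_coloring_imp_stc_labeling[OF assms, of 1] by auto
  then show ?thesis unfolding k1_def by (intro Least_le) blast
qed

text \<open>The colouring with all edges weak shows that the \<open>LEAST\<close> in
  \<open>k1\<close> ranges over a nonempty set and is attained.\<close>

lemma k1_witness:
  obtains f where "stc_coloring E (\<lambda>_. {1}) f" "card (weak_edges E f) = k1 E"
proof -
  have "stc_coloring E (\<lambda>_. {1}) (\<lambda>_. 0)" unfolding stc_coloring_def by auto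
  then obtain S where "stc_labeling E 1 S (weak_edges E (\<lambda>_. 0))"
    by (rule stc_coloring_imp_stc_labeling[of E "\<lambda>_. {1}" _ 1]) auto
  then have "\<exists>m S W. stc_labeling E 1 S W \<and> card W = m" by blast
  then have "\<exists>S W. stc_labeling E 1 S W \<and> card W = k1 E"
    unfolding k1_def by (rule LeastI_ex)
  then obtain S W where SW: "stc_labeling E 1 S W" "card W = k1 E" by blast
  moreover have "satisfies_lists E (\<lambda>_. {1}) S W"
    using SW(1) unfolding satisfies_lists_def stc_labeling_def labeling_def by auto
  ultimately show thesis
    using stc_labeling_imp_stc_coloring[of E 1 S W "\<lambda>_. {1}"] that by auto
qed

section \<open>The deletion criterion and its correctness\<close>

definition outer :: "'a set set \<Rightarrow> 'a \<Rightarrow> 'a \<Rightarrow> 'a set" where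
  "outer E v x = {z. {x, z} \<in> E \<and> z \<noteq> v \<and> {v, z} \<notin> E}"

text \<open>
  If \<open>v\<close> is simplicial, \<open>core E v\<close> is its critical clique, the set of vertices with the same
  closed neighbourhood.
\<close>

definition core :: "'a set set \<Rightarrow> 'a \<Rightarrow> 'a set" where
  "core E v = {u. (u = v \<or> {v, u} \<in> E) \<and> outer E v u = {}}"

definition same :: "'a set set \<Rightarrow> ('a set \<Rightarrow> nat set) \<Rightarrow> 'a \<Rightarrow> 'a \<Rightarrow> 'a set" where
  "same E \<Psi> v x = {u \<in> core E v. {x, u} \<in> E \<and> \<Psi> {x, u} = \<Psi> {v, x}}"

definition simplicial :: "'a set set \<Rightarrow> 'a \<Rightarrow> bool" where
  "simplicial E v \<longleftrightarrow> (\<forall>a b. {v, a} \<in> E \<longrightarrow> {v, b} \<in> E \<longrightarrow> a \<noteq> b \<longrightarrow> {a, b} \<in> E)"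

text \<open>In a finite graph the inequality restricts only neighbours \<open>x\<close> outside the
  critical clique: for \<open>x\<close> in it, \<open>outer E v x\<close> is empty, while
  \<open>v\<close> belongs to \<open>same E \<Psi> v x\<close>.\<close>

definition deletable :: "'a set set \<Rightarrow> ('a set \<Rightarrow> nat set) \<Rightarrow> 'a \<Rightarrow> bool" where
  "deletable E \<Psi> v \<longleftrightarrow> simplicial E v \<and>
     (\<forall>x. {v, x} \<in> E \<longrightarrow> \<Psi> {v, x} \<noteq> {} \<longrightarrow> card (outer E v x) < card (same E \<Psi> v x))"

text \<open>The third hypothesis prevents a triangle from losing exactly one edge, which would
  create a new path with non-adjacent ends. Edge sets of induced subgraphs satisfy it.\<close>

lemma stc_coloring_mono:
  assumes "stc_coloring E \<Psi> f" "E' \<subseteq> E" "\<And>u v w. {u, v} \<in> E' \<Longrightarrow> {v, w} \<in> E' \<Longrightarrow> {u, w} \<in> E \<Longrightarrow> {u, w} \<in> E'"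
  shows "stc_coloring E' \<Psi> f"
proof -
  have "f {u, v} \<noteq> f {v, w}"
    if "u \<noteq> w" "{u, v} \<in> E'" "{v, w} \<in> E'" "{u, w} \<notin> E'" "f {u, v} \<noteq> 0" for u v w
  proof -
    have "{u, v} \<in> E" "{v, w} \<in> E" "{u, w} \<notin> E" using assms(2,3) that by blast+
    then show ?thesis using assms(1) that unfolding stc_coloring_def by simp
  qed
  then show ?thesis using assms(1,2) unfolding stc_coloring_def by blast
qed

lemma finite_nbrs: "finite E \<Longrightarrow> finite {z. {x, z} \<in> E}"
proof -
  assume "finite E"
  moreover have "inj_on (\<lambda>z. {x, z}) {z. {x, z} \<in> E}" by (auto simp: inj_on_def doubleton_eq_iff)
  ultimately show ?thesis by (metis (no_types, lifting) finite_imageD finite_subset image_subsetI mem_Collect_eq)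
qed

text \<open>An edge with empty list is weak in every colouring, so the edges of this kind at
  \<open>v\<close> can be subtracted from the count.\<close>

lemma delete_forward:
  assumes fin: "finite E" and f: "stc_coloring E \<Psi> f"
    and X: "X = {e \<in> E. v \<in> e}"
  shows "stc_coloring (E - X) \<Psi> f"
    "card (weak_edges (E - X) f) + card {e \<in> X. \<Psi> e = {}} \<le> card (weak_edges E f)"
proof -
  show "stc_coloring (E - X) \<Psi> f" using f by (rule stc_coloring_mono) (auto simp: X)
  have "weak_edges (E - X) f \<union> {e \<in> X. \<Psi> e = {}} \<subseteq> weak_edges E f"
    using f unfolding weak_edges_def stc_coloring_def X by auto
  then have "card (weak_edges (E - X) f \<union> {e \<in> X. \<Psi> e = {}}) \<le> card (weak_edges E f)"
    using fin by (intro card_mono) (auto simp: weak_edges_def)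
  moreover have "card (weak_edges (E - X) f \<union> {e \<in> X. \<Psi> e = {}}) =
      card (weak_edges (E - X) f) + card {e \<in> X. \<Psi> e = {}}"
    using fin by (intro card_Un_disjoint) (auto simp: weak_edges_def X)
  ultimately show "card (weak_edges (E - X) f) + card {e \<in> X. \<Psi> e = {}} \<le> card (weak_edges E f)" by simp
qed

text \<open>
  A neighbour \<open>x\<close> of \<open>v\<close> is bad if all edges with the list of \<open>{v, x}\<close> from \<open>x\<close> to the rest of
  the critical clique are weak.  These are at least as many as the edges from \<open>x\<close> to the outside of
  the closed neighbourhood of \<open>v\<close>, so the former can be made strong at the expense of the latter,
  after which no path of length two through \<open>x\<close> restricts the colour of \<open>{v, x}\<close>.  If \<open>x\<close> is not
  bad, \<open>{v, x}\<close> copies the colour of a strong edge with the same list.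
\<close>

lemma delete_backward:
  assumes fin: "finite E" and two: "\<forall>e\<in>E. card e = 2"
    and del: "deletable E \<Psi> v" and X: "X = {e \<in> E. v \<in> e}"
    and f: "stc_coloring (E - X) \<Psi> f" and \<Psi>0: "\<forall>e\<in>E. 0 \<notin> \<Psi> e"
  obtains g where "stc_coloring E \<Psi> g"
    "card (weak_edges E g) \<le> card (weak_edges (E - X) f) + card {e \<in> X. \<Psi> e = {}}"
proof -
  have noloop: "{a, a} \<notin> E" for a using two by fastforce
  have com: "{a, b} = {b, a}" for a b :: 'a by auto
  have simp: "\<And>a b. {v, a} \<in> E \<Longrightarrow> {v, b} \<in> E \<Longrightarrow> a \<noteq> b \<Longrightarrow> {a, b} \<in> E"
    using del unfolding deletable_def simplicial_def by blast
  define K where "K = core E v"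
  have vK: "v \<in> K" unfolding K_def core_def outer_def by auto
  have Kv: "u = v \<or> {v, u} \<in> E" if "u \<in> K" for u using that unfolding K_def core_def by auto
  have Kn: "z = v \<or> {v, z} \<in> E" if "u \<in> K" "{u, z} \<in> E" for u z
    using that unfolding K_def core_def outer_def by auto
  have clique: "{a, b} \<in> E" if "a = v \<or> {v, a} \<in> E" "b = v \<or> {v, b} \<in> E" "a \<noteq> b" for a b
    using that simp by (metis com)
  define A where "A x = {u \<in> K. u \<noteq> v \<and> {x, u} \<in> E \<and> \<Psi> {x, u} = \<Psi> {v, x}}" for x
  define O' where "O' x = outer E v x" for x
  define Bad where "Bad = {x. {v, x} \<in> E \<and> x \<notin> K \<and> \<Psi> {v, x} \<noteq> {} \<and> (\<forall>u\<in>A x. f {x, u} = 0)}"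
  have finN: "finite {z. {x, z} \<in> E}" for x using fin by (rule finite_nbrs)
  have finA: "finite (A x)" for x by (rule finite_subset[OF _ finN[of x]]) (auto simp: A_def)
  have finO: "finite (O' x)" for x by (rule finite_subset[OF _ finN[of x]]) (auto simp: O'_def outer_def)
  have finBad: "finite Bad" by (rule finite_subset[OF _ finN[of v]]) (auto simp: Bad_def)
  have card_OA: "card (O' x) \<le> card (A x)" if "x \<in> Bad" for x
  proof -
    have x: "{v, x} \<in> E" "\<Psi> {v, x} \<noteq> {}" using that unfolding Bad_def by auto
    have "card (O' x) < card (same E \<Psi> v x)"
      using del x unfolding deletable_def O'_def by auto
    \<comment> \<open>\<open>A x\<close> is what remains of \<open>same E \<Psi> v x\<close> once
      \<open>v\<close> is gone; the strict inequality pays for this loss of one.\<close>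
    also have "same E \<Psi> v x = insert v (A x)"
      using x vK unfolding same_def A_def K_def by (auto simp: com)
    also have "card \<dots> = Suc (card (A x))" using finA by (simp add: A_def)
    finally show ?thesis by simp
  qed
  define pick where "pick e = (SOME i. i \<in> \<Psi> e)" for e
  have pick: "pick e \<in> \<Psi> e" if "\<Psi> e \<noteq> {}" for e unfolding pick_def using that by (simp add: some_in_eq)
  define rep where "rep x = (SOME u. u \<in> A x \<and> f {x, u} \<noteq> 0)" for x
  have rep: "rep x \<in> A x \<and> f {x, rep x} \<noteq> 0"
    if "{v, x} \<in> E" "x \<notin> K" "x \<notin> Bad" "\<Psi> {v, x} \<noteq> {}" for x
    unfolding rep_def by (rule someI_ex) (use that in \<open>auto simp: Bad_def\<close>)
  define AE where "AE = (\<Union>x\<in>Bad. (\<lambda>u. {x, u}) ` A x)"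
  define OE where "OE = (\<Union>x\<in>Bad. (\<lambda>z. {x, z}) ` O' x)"
  \<comment> \<open>An arbitrary colour of the list is safe in three cases. An edge from
    \<open>v\<close> into \<open>K\<close> lies on no path of length two with non-adjacent ends. An
    edge from a bad vertex \<open>x\<close> to \<open>v\<close> or to \<open>A x\<close> lies only
    on such paths that leave \<open>x\<close> through \<open>OE\<close>, and those edges become
    weak.\<close>
  define g where "g e = (if v \<in> e then
       (if \<Psi> e = {} then 0 else
          if (\<exists>x. e = {v, x} \<and> x \<notin> K \<and> x \<notin> Bad)
          then f {THE x. e = {v, x}, rep (THE x. e = {v, x})} else pick e)
     else if e \<in> OE then 0 else if e \<in> AE then pick e else f e)" for e
  have the: "(THE x. {v, y} = {v, x}) = y" if "y \<noteq> v" for y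
    using that by (auto simp: doubleton_eq_iff)
  have g_v: "g {v, x} = f {x, rep x}" if "{v, x} \<in> E" "\<Psi> {v, x} \<noteq> {}" "x \<notin> K" "x \<notin> Bad" for x
  proof -
    have "x \<noteq> v" using that(1) noloop by auto
    then show ?thesis unfolding g_def using that the[of x] by auto
  qed
  have AE_E: "AE \<subseteq> E - X" and OE_E: "OE \<subseteq> E - X"
    using vK unfolding AE_def OE_def X A_def O'_def outer_def Bad_def by auto
  have AE_weak: "f e = 0" if "e \<in> AE" for e using that unfolding AE_def Bad_def by auto
  have AE_ne: "\<Psi> e \<noteq> {}" if "e \<in> AE" for e using that unfolding AE_def Bad_def A_def by auto
  have not_v: "v \<notin> e" if "e \<in> E - X" for e using that unfolding X by auto

  have weak_g: "weak_edges E g \<subseteq> (weak_edges (E - X) f - AE) \<union> OE \<union> {e \<in> X. \<Psi> e = {}}"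
  proof
    fix e assume e: "e \<in> weak_edges E g"
    then have eE: "e \<in> E" "g e = 0" unfolding weak_edges_def by auto
    show "e \<in> (weak_edges (E - X) f - AE) \<union> OE \<union> {e \<in> X. \<Psi> e = {}}"
    proof (cases "v \<in> e")
      case True
      have "\<Psi> e = {}"
      proof (rule ccontr)
        assume ne: "\<Psi> e \<noteq> {}"
        show False
        proof (cases "\<exists>x. e = {v, x} \<and> x \<notin> K \<and> x \<notin> Bad")
          case True
          then obtain x where x: "e = {v, x}" "x \<notin> K" "x \<notin> Bad" by blast
          then show False using g_v[of x] rep[of x] ne eE by auto
        next
          case False
          then have "g e = pick e" using ne \<open>v \<in> e\<close> unfolding g_def by auto
          then show False using pick[OF ne] \<Psi>0 eE by auto
        qed
      qed
      then show ?thesis using True eE X by auto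
    next
      case False
      then have "e \<in> E - X" using eE X by auto
      moreover have "e \<notin> AE" if "e \<notin> OE"
      proof
        assume "e \<in> AE"
        then have "g e = pick e" using False that unfolding g_def by auto
        then show False using pick[OF AE_ne[OF \<open>e \<in> AE\<close>]] \<Psi>0 eE by auto
      qed
      moreover have "f e = 0" if "e \<notin> OE" "e \<notin> AE"
        using that False eE unfolding g_def by auto
      ultimately show ?thesis unfolding weak_edges_def by blast
    qed
  qed
  have card_OE: "card OE \<le> (\<Sum>x\<in>Bad. card (O' x))"
    unfolding OE_def
    by (rule order_trans[OF card_UN_le[OF finBad]]) (intro sum_mono card_image_le finO)
  have card_AE: "card AE = (\<Sum>x\<in>Bad. card (A x))"
  proof -
    have "card AE = (\<Sum>x\<in>Bad. card ((\<lambda>u. {x, u}) ` A x))"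
      unfolding AE_def
    \<comment> \<open>Each edge in \<open>AE\<close> has exactly one end in \<open>K\<close>, so its
      other end determines the bad vertex it comes from.\<close>
    proof (intro card_UN_disjoint finBad ballI impI finite_imageI finA)
      fix x y assume "x \<in> Bad" "y \<in> Bad" "x \<noteq> y"
      then show "(\<lambda>u. {x, u}) ` A x \<inter> (\<lambda>u. {y, u}) ` A y = {}"
        unfolding Bad_def A_def by (auto simp: doubleton_eq_iff)
    qed
    also have "\<dots> = (\<Sum>x\<in>Bad. card (A x))"
      by (intro sum.cong refl card_image) (auto simp: inj_on_def doubleton_eq_iff)
    finally show ?thesis .
  qed
  have AE_sub: "AE \<subseteq> weak_edges (E - X) f" using AE_E AE_weak unfolding weak_edges_def by auto
  have finW: "finite (weak_edges (E - X) f)" using fin unfolding weak_edges_def by auto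
  have finOE: "finite OE" using OE_E fin by (meson finite_Diff finite_subset)
  have finX: "finite {e \<in> X. \<Psi> e = {}}" using fin X by auto
  have "card (weak_edges E g) \<le> card ((weak_edges (E - X) f - AE) \<union> OE \<union> {e \<in> X. \<Psi> e = {}})"
    using weak_g finW finOE finX by (intro card_mono) auto
  also have "\<dots> \<le> card (weak_edges (E - X) f - AE) + card OE + card {e \<in> X. \<Psi> e = {}}"
    by (meson card_Un_le le_trans add_le_mono1)
  also have "\<dots> \<le> card (weak_edges (E - X) f - AE) + card AE + card {e \<in> X. \<Psi> e = {}}"
    using card_OE card_AE sum_mono[of Bad "\<lambda>x. card (O' x)" "\<lambda>x. card (A x)"] card_OA by simp
  also have "card (weak_edges (E - X) f - AE) + card AE = card (weak_edges (E - X) f)"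
    using AE_sub finW by (metis card_Diff_subset card_mono finite_subset le_add_diff_inverse2)
  finally have bound: "card (weak_edges E g) \<le> card (weak_edges (E - X) f) + card {e \<in> X. \<Psi> e = {}}" .

  \<comment> \<open>Away from \<open>K\<close> the new colouring differs from \<open>f\<close> only
    by weakening edges, which creates no conflict.\<close>
  have g_out: "g e = 0 \<or> g e = f e" if "e \<inter> K = {}" for e
    using that vK unfolding g_def AE_def A_def by auto
  have f_confl: "f {a, b} \<noteq> f {b, d}"
    if "a \<noteq> d" "{a, b} \<in> E" "{b, d} \<in> E" "{a, d} \<notin> E" "a \<noteq> v" "b \<noteq> v" "d \<noteq> v" "f {a, b} \<noteq> 0"
    for a b d
    using f that unfolding stc_coloring_def X by auto
  \<comment> \<open>If one end of a path with non-adjacent ends lies in \<open>K\<close>, then its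
    centre \<open>b\<close> is a neighbour of \<open>v\<close> outside \<open>K\<close> and its
    other end \<open>d\<close> is outside the closed neighbourhood of \<open>v\<close>. So
    \<open>{b, d}\<close> is one of the edges weakened when \<open>b\<close> is bad.\<close>
  have core_case: "g {a, b} = 0 \<or> g {b, d} = 0 \<or> g {a, b} \<noteq> g {b, d}"
    if p3: "a \<noteq> d" "{a, b} \<in> E" "{b, d} \<in> E" "{a, d} \<notin> E" and aK: "a \<in> K" for a b d
  proof -
    have bN: "b = v \<or> {v, b} \<in> E" using Kn aK p3(2) by blast
    have dN: "\<not> (d = v \<or> {v, d} \<in> E)" using clique[of a d] Kv[OF aK] p3 by auto
    then have dK: "d \<notin> K" using Kv by auto
    have bK: "b \<notin> K" using Kn[OF _ p3(3)] dN by auto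
    then have bv: "b \<noteq> v" "{v, b} \<in> E" using vK bN by auto
    have ab: "a \<noteq> b" "b \<noteq> d" using aK bK p3(3) noloop by auto
    have dO: "d \<in> O' b" using dN p3(3) unfolding O'_def outer_def by (auto simp: com)
    have v_bd: "v \<notin> {b, d}" using bv dN by auto
    show ?thesis
    proof (cases "b \<in> Bad")
      case True
      then have "{b, d} \<in> OE" using dO unfolding OE_def by auto
      then show ?thesis using v_bd unfolding g_def by simp
    next
      case False
      have g_bd: "g {b, d} = 0 \<or> g {b, d} = f {b, d}" using g_out[of "{b, d}"] bK dK by auto
      show ?thesis
      proof (cases "a = v")
        case True
        show ?thesis
        proof (cases "\<Psi> {v, b} = {}")
          case True
          then show ?thesis using \<open>a = v\<close> unfolding g_def by simp
        next
          case ne: False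
          have "g {a, b} = f {b, rep b}" using g_v[OF bv(2) ne bK False] True by simp
          moreover from rep[OF bv(2) bK False ne]
          have r: "rep b \<in> K" "rep b \<noteq> v" "{b, rep b} \<in> E" "f {b, rep b} \<noteq> 0"
            unfolding A_def by auto
          \<comment> \<open>The path \<open>rep b\<close>, \<open>b\<close>, \<open>d\<close>
            survives the deletion of \<open>v\<close> and has non-adjacent ends, so \<open>f\<close>
            already separates the copied colour from that of \<open>{b, d}\<close>.\<close>
          have "f {rep b, b} \<noteq> f {b, d}"
            using r dK dN bv p3(3) Kn[OF r(1), of d] by (intro f_confl) (auto simp: com)
          ultimately show ?thesis using g_bd by (auto simp: com)
        qed
      next
        case av: False
        have "{a, b} \<notin> AE"
        proof
          assume "{a, b} \<in> AE"
          then obtain x u where "x \<in> Bad" "u \<in> A x" "{a, b} = {x, u}" unfolding AE_def by auto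
          then show False using False bK aK unfolding A_def Bad_def by (auto simp: doubleton_eq_iff)
        qed
        then have "g {a, b} = 0 \<or> g {a, b} = f {a, b}" using av bv unfolding g_def by auto
        moreover have "f {a, b} = 0 \<or> f {a, b} \<noteq> f {b, d}"
          using f_confl[OF p3] av bv dN by auto
        ultimately show ?thesis using g_bd by auto
      qed
    qed
  qed
  have "stc_coloring E \<Psi> g"
    unfolding stc_coloring_def
  proof (intro conjI ballI allI impI)
    fix e assume e: "e \<in> E"
    show "g e = 0 \<or> g e \<in> \<Psi> e"
    proof (cases "v \<in> e \<and> \<Psi> e \<noteq> {} \<and> (\<exists>x. e = {v, x} \<and> x \<notin> K \<and> x \<notin> Bad)")
      case True
      then obtain x where x: "e = {v, x}" "x \<notin> K" "x \<notin> Bad" "\<Psi> e \<noteq> {}" by blast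
      have "g e = f {x, rep x}" using g_v x e by auto
      moreover have r: "rep x \<in> A x" using rep x e by auto
      then have "{x, rep x} \<in> E - X" "\<Psi> {x, rep x} = \<Psi> e"
        using x vK unfolding A_def X by auto
      ultimately show ?thesis using f unfolding stc_coloring_def by metis
    next
      case False
      show ?thesis
      proof (cases "v \<in> e")
        case True
        then show ?thesis using False pick[of e] unfolding g_def by auto
      next
        case False
        then have "f e = 0 \<or> f e \<in> \<Psi> e" using f e unfolding stc_coloring_def X by auto
        then show ?thesis using False pick[of e] AE_ne[of e] unfolding g_def by auto
      qed
    qed
  next
    fix a b d assume p3: "a \<noteq> d" "{a, b} \<in> E" "{b, d} \<in> E" "{a, d} \<notin> E" "g {a, b} \<noteq> 0"
    show "g {a, b} \<noteq> g {b, d}"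
    proof (cases "a \<in> K \<or> d \<in> K")
      case True
      then show ?thesis
      proof
        assume "a \<in> K"
        then show ?thesis using core_case[OF p3(1-4)] p3(5) by auto
      next
        assume "d \<in> K"
        then have "g {d, b} = 0 \<or> g {b, a} = 0 \<or> g {d, b} \<noteq> g {b, a}"
          using p3 by (intro core_case) (auto simp: com)
        then show ?thesis using p3(5) by (auto simp: com)
      qed
    next
      case False
      \<comment> \<open>All neighbours of a vertex in \<open>K\<close> lie in the closed
        neighbourhood of \<open>v\<close>, which is a clique, so \<open>K\<close> contains no centre
        of such a path.\<close>
      have "b \<notin> K"
      proof
        assume b: "b \<in> K"
        have "{b, a} \<in> E" using p3(2) by (simp add: com)
        then show False using clique[OF Kn[OF b] Kn[OF b p3(3)] p3(1)] p3(4) by auto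
      qed
      then have "g {a, b} = f {a, b}" "g {b, d} = 0 \<or> g {b, d} = f {b, d}"
        using g_out[of "{a, b}"] g_out[of "{b, d}"] False p3(5) by auto
      moreover have "a \<noteq> v" "b \<noteq> v" "d \<noteq> v" using False \<open>b \<notin> K\<close> vK by auto
      ultimately show ?thesis using f_confl[OF p3(1-4)] p3(5) by auto
    qed
  qed
  then show thesis using bound that by blast
qed

section \<open>Counting vertices when none is deletable\<close>

text \<open>Handshake identity by double counting of incidences. Applied to the weak edges it yields
  the factor \<open>2 * k1\<close>.\<close>

lemma sum_degree:
  assumes "finite V" "finite W" "\<forall>e\<in>W. card e = 2 \<and> e \<subseteq> V"
  shows "(\<Sum>x\<in>V. card {z. {x, z} \<in> W}) = 2 * card W"
proof -
  have "card {z. {x, z} \<in> W} = card {e \<in> W. x \<in> e}" for x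
  proof (rule bij_betw_same_card[of "\<lambda>z. {x, z}"])
    have "\<exists>z. e = {x, z}" if e: "e \<in> W" "x \<in> e" for e
    proof -
      obtain a b where "e = {a, b}" using assms(3) e(1) by (meson card_2_iff)
      then show ?thesis using e(2) by auto
    qed
    then show "bij_betw (\<lambda>z. {x, z}) {z. {x, z} \<in> W} {e \<in> W. x \<in> e}"
      by (fastforce simp: bij_betw_def inj_on_def doubleton_eq_iff image_iff)
  qed
  then have "(\<Sum>x\<in>V. card {z. {x, z} \<in> W}) = (\<Sum>x\<in>V. card {e \<in> W. x \<in> e})" by simp
  also have "\<dots> = (\<Sum>e\<in>W. card {x \<in> V. x \<in> e})"
    using assms(1,2) by (intro sum_multicount_gen) auto
  also have "\<dots> = (\<Sum>e\<in>W. 2)"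
  proof (intro sum.cong refl)
    fix e assume "e \<in> W"
    then have "{x \<in> V. x \<in> e} = e" using assms(3) by auto
    then show "card {x \<in> V. x \<in> e} = 2" using assms(3) \<open>e \<in> W\<close> by auto
  qed
  finally show ?thesis by simp
qed

text \<open>
  In an optimal labeling with one colour, a vertex \<open>y\<close> without weak edges is simplicial.  As it is
  not deletable, some neighbour \<open>x\<close> with list \<open>\<psi>\<close> violates the condition.  All \<open>y\<close> belonging to
  the same pair \<open>(x, \<psi>)\<close> lie in one critical clique, so there are at most as many as edges from
  \<open>x\<close> to the outside, and those are weak.
\<close>

lemma kernel_bound:
  assumes V: "finite V" and E: "E \<subseteq> nsets V 2" and no: "\<forall>v\<in>V. \<not> deletable E \<Psi> v"
  shows "card V \<le> (card (\<Psi> ` E - {{}}) + 1) * (2 * k1 E)"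
proof -
  have fin: "finite E"
    using finite_subset[OF E finite_imp_finite_nsets[OF V]] .
  have two: "card e = 2 \<and> e \<subseteq> V" if "e \<in> E" for e using E that unfolding nsets_def by auto
  have noloop: "{a, a} \<notin> E" for a using two by fastforce
  have com: "{a, b} = {b, a}" for a b :: 'a by auto
  obtain f where f: "stc_coloring E (\<lambda>_. {1}) f" and k1: "card (weak_edges E f) = k1 E" by (rule k1_witness)
  define W where "W = weak_edges E f"
  have WE: "W \<subseteq> E" unfolding W_def weak_edges_def by auto
  have strong: "{u, w} \<in> E" if "{u, v} \<in> E - W" "{v, w} \<in> E - W" "u \<noteq> w" for u v w
  proof -
    have one: "f e = 1" if "e \<in> E - W" for e
      using f that unfolding stc_coloring_def W_def weak_edges_def by auto
    have "{u, w} \<notin> E \<longrightarrow> f {u, v} \<noteq> 0 \<longrightarrow> f {u, v} \<noteq> f {v, w}"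
      using f that unfolding stc_coloring_def by simp
    then show ?thesis using one[OF that(1)] one[OF that(2)] by auto
  qed
  define d where "d x = card {z. {x, z} \<in> W}" for x
  have finW: "finite W" using WE fin finite_subset by auto
  have sum_d: "(\<Sum>x\<in>V. d x) = 2 * k1 E"
    using sum_degree[OF V finW] WE two k1 unfolding d_def W_def by auto
  define T where "T = \<Psi> ` E - {{}}"
  have finT: "finite T" using fin unfolding T_def by auto
  define Y where "Y = {y \<in> V. \<forall>z. {y, z} \<notin> W}"
  have finY: "finite Y" using V unfolding Y_def by auto
  have Ysimp: "simplicial E y" if "y \<in> Y" for y
    using that strong[of _ y] unfolding simplicial_def Y_def by (auto simp: com)
  define F where "F x \<psi> = {y \<in> Y. {y, x} \<in> E \<and> \<Psi> {y, x} = \<psi> \<and> card (same E \<Psi> y x) \<le> card (outer E y x)}"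
    for x \<psi>
  \<comment> \<open>Vertices outside \<open>Y\<close> have positive weak degree; they account for
    the summand 1 in \<tau> + 1.\<close>
  have cardX: "card (V - Y) \<le> (\<Sum>x\<in>V. d x)"
  proof -
    have "1 \<le> d x" if "x \<in> V - Y" for x
    proof -
      have "{z. {x, z} \<in> W} \<noteq> {}" using that unfolding Y_def by auto
      then show ?thesis unfolding d_def using finite_nbrs[OF finW, of x]
        by (metis One_nat_def Suc_leI card_gt_0_iff)
    qed
    then have "(\<Sum>x\<in>V - Y. 1) \<le> (\<Sum>x\<in>V - Y. d x)" by (intro sum_mono) auto
    also have "\<dots> \<le> (\<Sum>x\<in>V. d x)" using V by (intro sum_mono2) auto
    finally show ?thesis by simp
  qed
  have Y_sub: "Y \<subseteq> (\<Union>x\<in>V. \<Union>\<psi>\<in>T. F x \<psi>)"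
  proof
    fix y assume y: "y \<in> Y"
    then have "\<not> deletable E \<Psi> y" using no unfolding Y_def by auto
    then obtain x where x: "{y, x} \<in> E" "\<Psi> {y, x} \<noteq> {}" "card (same E \<Psi> y x) \<le> card (outer E y x)"
      using Ysimp[OF y] unfolding deletable_def by (auto simp: not_less)
    then have "y \<in> F x (\<Psi> {y, x})" using y unfolding F_def by auto
    moreover have "x \<in> V" "\<Psi> {y, x} \<in> T" using x two unfolding T_def by auto
    ultimately show "y \<in> (\<Union>x\<in>V. \<Union>\<psi>\<in>T. F x \<psi>)" by blast
  qed
  have F_le: "card (F x \<psi>) \<le> d x" for x \<psi>
  proof (cases "F x \<psi> = {}")
    case False
    then obtain y where y: "y \<in> Y" "{y, x} \<in> E" "\<Psi> {y, x} = \<psi>" "card (same E \<Psi> y x) \<le> card (outer E y x)"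
      unfolding F_def by auto
    have yx: "{y, x} \<in> E - W" using y unfolding Y_def by auto
    \<comment> \<open>Two members of \<open>F x \<psi>\<close> both have strong edges to
      \<open>x\<close> and are thus adjacent. As both are simplicial, their closed neighbourhoods
      coincide, and one representative \<open>y\<close> has the whole group in its
      \<open>same\<close> set.\<close>
    have "F x \<psi> \<subseteq> same E \<Psi> y x"
    proof
      fix y' assume y': "y' \<in> F x \<psi>"
      then have y': "y' \<in> Y" "{y', x} \<in> E" "\<Psi> {y', x} = \<psi>" unfolding F_def by auto
      have y'x: "{y', x} \<in> E - W" using y' unfolding Y_def by auto
      have adj: "y' = y \<or> {y, y'} \<in> E" using strong[of y x y'] yx y'x by (auto simp: com)
      have "y' \<in> core E y"
        unfolding core_def outer_def
      proof (safe; (use adj in simp; fail)?)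
        fix z assume z: "{y', z} \<in> E" "{y, z} \<notin> E" "z \<noteq> y"
        then have "y' \<noteq> y" by auto
        then have "{y', y} \<in> E" using adj by (auto simp: com)
        then have "{y, z} \<in> E" using Ysimp[OF y'(1)] z unfolding simplicial_def by blast
        then show "z \<in> {}" using z by simp
      qed
      then show "y' \<in> same E \<Psi> y x" using y' y unfolding same_def by (auto simp: com)
    qed
    moreover have "finite (same E \<Psi> y x)"
      by (rule finite_subset[OF _ finite_nbrs[OF fin, of x]]) (auto simp: same_def)
    ultimately have "card (F x \<psi>) \<le> card (same E \<Psi> y x)" by (rule card_mono[rotated])
    also have "\<dots> \<le> card (outer E y x)" by (rule y(4))
    \<comment> \<open>The edge \<open>{y, x}\<close> is strong, so a strong edge
      \<open>{x, z}\<close> would force \<open>y\<close> and \<open>z\<close> to be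
      adjacent.\<close>
    also have "\<dots> \<le> d x"
      unfolding d_def
    proof (intro card_mono finite_nbrs[OF finW] subsetI CollectI)
      fix z assume "z \<in> outer E y x"
      then show "{x, z} \<in> W" using strong[of y x z] yx unfolding outer_def by auto
    qed
    finally show ?thesis .
  qed simp
  have "finite (F x \<psi>)" for x \<psi> using finY unfolding F_def by auto
  then have "card Y \<le> card (\<Union>x\<in>V. \<Union>\<psi>\<in>T. F x \<psi>)"
    using V finT by (intro card_mono Y_sub) auto
  also have "\<dots> \<le> (\<Sum>x\<in>V. card (\<Union>\<psi>\<in>T. F x \<psi>))" by (rule card_UN_le[OF V])
  also have "\<dots> \<le> (\<Sum>x\<in>V. \<Sum>\<psi>\<in>T. card (F x \<psi>))" by (intro sum_mono card_UN_le[OF finT])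
  also have "\<dots> \<le> (\<Sum>x\<in>V. \<Sum>\<psi>\<in>T. d x)" by (intro sum_mono F_le)
  also have "\<dots> = card T * (2 * k1 E)" by (simp add: sum_d flip: sum_distrib_left)
  finally have "card Y \<le> card T * (2 * k1 E)" .
  moreover have "card V = card Y + card (V - Y)"
    using card_mono[OF V] card_Diff_subset[OF finY] by (simp add: Y_def)
  ultimately show ?thesis using cardX sum_d unfolding T_def by simp
qed

section \<open>Deletion on instances with a budget\<close>

definition induced :: "el_instance \<Rightarrow> nat set \<Rightarrow> nat set set" where
  "induced I U = {e \<in> edges I. e \<subseteq> U}"

text \<open>The lost edges with empty lists are counted against the original edge set, so the budget
  depends only on \<open>U\<close> and not on the order of deletions.\<close>

definition subinstance :: "el_instance \<Rightarrow> nat set \<Rightarrow> el_instance" where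
  "subinstance I U = \<lparr>verts = U, edges = induced I U, colors = colors I,
     budget = budget I - int (card {e \<in> edges I. \<not> e \<subseteq> U \<and> edge_lists I e = {}}),
     edge_lists = edge_lists I\<rparr>"

definition step :: "el_instance \<Rightarrow> nat set \<Rightarrow> nat set \<Rightarrow> bool" where
  "step I U U' \<longleftrightarrow> (\<exists>v\<in>U. deletable (induced I U) (edge_lists I) v \<and> U' = U - {v})"

lemma wf_subinstance: "wf_instance I \<Longrightarrow> U \<subseteq> verts I \<Longrightarrow> wf_instance (subinstance I U)"
  unfolding wf_instance_def subinstance_def induced_def nsets_def
  by (auto intro: finite_subset)

lemma wf_finite_edges: "wf_instance I \<Longrightarrow> finite (edges I)"
  unfolding wf_instance_def using finite_imp_finite_nsets finite_subset by blast

lemma wf_card_edge: "wf_instance I \<Longrightarrow> e \<in> edges I \<Longrightarrow> card e = 2"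
  unfolding wf_instance_def nsets_def by auto

lemma wf_finite_list: "wf_instance I \<Longrightarrow> e \<in> edges I \<Longrightarrow> finite (edge_lists I e)"
  unfolding wf_instance_def by (meson finite_atLeastAtMost finite_subset)

lemma step_equivalent:
  assumes wf: "wf_instance I" and U: "U \<subseteq> verts I" and "step I U U'"
  shows "el_multi_stc (subinstance I U') \<longleftrightarrow> el_multi_stc (subinstance I U)"
proof -
  obtain v where v: "v \<in> U" "deletable (induced I U) (edge_lists I) v" "U' = U - {v}"
    using assms(3) unfolding step_def by blast
  let ?E = "induced I U" and ?\<Psi> = "edge_lists I"
  define X where "X = {e \<in> ?E. v \<in> e}"
  have fin: "finite ?E" and two: "\<forall>e\<in>?E. card e = 2"
    using wf_finite_edges[OF wf] wf_card_edge[OF wf] unfolding induced_def by auto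
  have \<Psi>0: "\<forall>e\<in>?E. 0 \<notin> ?\<Psi> e" using wf unfolding wf_instance_def induced_def by force
  have E': "induced I U' = ?E - X" unfolding induced_def X_def v(3) by auto
  have "{e \<in> edges I. \<not> e \<subseteq> U' \<and> ?\<Psi> e = {}} =
     {e \<in> edges I. \<not> e \<subseteq> U \<and> ?\<Psi> e = {}} \<union> {e \<in> X. ?\<Psi> e = {}}"
    unfolding X_def v(3) induced_def by auto
  moreover have "card ({e \<in> edges I. \<not> e \<subseteq> U \<and> ?\<Psi> e = {}} \<union> {e \<in> X. ?\<Psi> e = {}}) =
     card {e \<in> edges I. \<not> e \<subseteq> U \<and> ?\<Psi> e = {}} + card {e \<in> X. ?\<Psi> e = {}}"
    using wf_finite_edges[OF wf] fin by (intro card_Un_disjoint) (auto simp: X_def induced_def)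
  ultimately have budget: "budget (subinstance I U') =
      budget (subinstance I U) - int (card {e \<in> X. ?\<Psi> e = {}})"
    unfolding subinstance_def by simp
  have wfU: "wf_instance (subinstance I U)" "wf_instance (subinstance I U')"
    using wf_subinstance[OF wf, of U] wf_subinstance[OF wf, of U'] U v(3) by auto
  show ?thesis
  proof
    assume "el_multi_stc (subinstance I U)"
    then obtain f where f: "stc_coloring ?E ?\<Psi> f" "int (card (weak_edges ?E f)) \<le> budget (subinstance I U)"
      using el_multi_stc_iff[OF wfU(1)] unfolding subinstance_def by auto
    have "stc_coloring (?E - X) ?\<Psi> f \<and> int (card (weak_edges (?E - X) f)) \<le> budget (subinstance I U')"
      using delete_forward[OF fin f(1) X_def] f(2) budget by auto
    then show "el_multi_stc (subinstance I U')"
      unfolding el_multi_stc_iff[OF wfU(2)] by (auto simp: subinstance_def E')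
  next
    assume "el_multi_stc (subinstance I U')"
    then obtain f where f: "stc_coloring (?E - X) ?\<Psi> f"
      "int (card (weak_edges (?E - X) f)) \<le> budget (subinstance I U')"
      using el_multi_stc_iff[OF wfU(2)] unfolding subinstance_def by (auto simp: E')
    obtain g where "stc_coloring ?E ?\<Psi> g"
      "card (weak_edges ?E g) \<le> card (weak_edges (?E - X) f) + card {e \<in> X. ?\<Psi> e = {}}"
      using delete_backward[OF fin two v(2) X_def f(1) \<Psi>0] by blast
    then have "stc_coloring ?E ?\<Psi> g \<and> int (card (weak_edges ?E g)) \<le> budget (subinstance I U)"
      using f(2) budget by auto
    then show "el_multi_stc (subinstance I U)"
      unfolding el_multi_stc_iff[OF wfU(1)] by (auto simp: subinstance_def)
  qed
qed

lemma steps_subset: "(step I)\<^sup>*\<^sup>* U U' \<Longrightarrow> U' \<subseteq> U"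
  by (induction rule: rtranclp_induct) (auto simp: step_def)

lemma steps_equivalent:
  assumes "wf_instance I" "(step I)\<^sup>*\<^sup>* U U'" "U \<subseteq> verts I"
  shows "el_multi_stc (subinstance I U') \<longleftrightarrow> el_multi_stc (subinstance I U)"
  using assms(2)
proof (induction rule: rtranclp_induct)
  case (step U' U'')
  then show ?case using step_equivalent[OF assms(1) _ step.hyps(2)] steps_subset[OF step.hyps(1)] assms(3)
    by auto
qed simp

lemma subinstance_verts:
  assumes "wf_instance I"
  shows "subinstance I (verts I) = I"
proof -
  have *: "e \<subseteq> verts I" if "e \<in> edges I" for e
    using assms that unfolding wf_instance_def nsets_def by auto
  have ind: "induced I (verts I) = edges I"
    and none: "{e \<in> edges I. \<not> e \<subseteq> verts I \<and> edge_lists I e = {}} = {}"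
    unfolding induced_def using * by auto
  show ?thesis unfolding subinstance_def ind none by simp
qed

text \<open>An optimal labeling restricts to induced subgraphs. This turns the bound for the reduced
  graph into one in the parameter of the input.\<close>

lemma k1_induced_le:
  assumes "finite (edges I)"
  shows "k1 (induced I U) \<le> k1 (edges I)"
proof -
  obtain f where f: "stc_coloring (edges I) (\<lambda>_. {1}) f" "card (weak_edges (edges I) f) = k1 (edges I)"
    by (rule k1_witness)
  have "stc_coloring (induced I U) (\<lambda>_. {1}) f"
    using f(1) by (rule stc_coloring_mono) (auto simp: induced_def)
  then have "k1 (induced I U) \<le> card (weak_edges (induced I U) f)" by (rule k1_le)
  also have "\<dots> \<le> card (weak_edges (edges I) f)"
    using assms by (intro card_mono) (auto simp: weak_edges_def induced_def)
  finally show ?thesis using f(2) by simp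
qed

lemma subinstance_bound:
  assumes wf: "wf_instance I" and U: "U \<subseteq> verts I"
    and no: "\<forall>v\<in>U. \<not> deletable (induced I U) (edge_lists I) v"
  shows "card U \<le> (tau I + 1) * (2 * k1 (edges I))"
proof -
  have "induced I U \<subseteq> nsets U 2" "finite U"
    using wf_subinstance[OF wf U] unfolding wf_instance_def subinstance_def by auto
  then have "card U \<le> (card (edge_lists I ` induced I U - {{}}) + 1) * (2 * k1 (induced I U))"
    using no by (intro kernel_bound)
  also have "\<dots> \<le> (tau I + 1) * (2 * k1 (edges I))"
    unfolding tau_def using wf_finite_edges[OF wf]
    by (intro mult_mono add_mono k1_induced_le card_mono) (auto simp: induced_def)
  finally show ?thesis .
qed

section \<open>The algorithm\<close>

text \<open>
  The functions prefixed by \<open>v_\<close> work on encodings and are defined for arbitrary trees, including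
  those that encode nothing.
\<close>

definition joins :: "val \<Rightarrow> val \<Rightarrow> val \<Rightarrow> bool" where
  "joins e u v \<longleftrightarrow> vfst e = u \<and> vfst (vsnd e) = v \<or> vfst e = v \<and> vfst (vsnd e) = u"

definition v_adj :: "val \<Rightarrow> val \<Rightarrow> val \<Rightarrow> bool" where
  "v_adj E u v \<longleftrightarrow> (\<exists>e\<in>set (elems E). joins e u v)"

definition v_outer :: "val \<Rightarrow> val \<Rightarrow> val \<Rightarrow> val \<Rightarrow> bool" where
  "v_outer E v x z \<longleftrightarrow> v_adj E x z \<and> z \<noteq> v \<and> \<not> v_adj E v z"

definition v_same :: "val \<Rightarrow> val \<Rightarrow> val \<Rightarrow> val \<Rightarrow> val \<Rightarrow> bool" where
  "v_same E U v x u \<longleftrightarrow> ((u = v \<or> v_adj E v u) \<and> \<not> (\<exists>z\<in>set (elems U). v_outer E v u z)) \<and>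
     (\<exists>e\<in>set (elems E). joins e x u \<and>
        (\<exists>e'\<in>set (elems E). joins e' v x \<and> vsnd (vsnd e) = vsnd (vsnd e')))"

text \<open>The edge list of the input graph is never modified: quantifying and counting over
  \<open>U\<close> alone simulates the induced subgraph. Implications are spelled as disjunctions to
  match the closure rules in \<open>ptime_intros\<close>.\<close>

definition v_deletable :: "val \<Rightarrow> val \<Rightarrow> val \<Rightarrow> bool" where
  "v_deletable E U v \<longleftrightarrow>
     (\<forall>a\<in>set (elems U). \<forall>b\<in>set (elems U).
        \<not> v_adj E v a \<or> \<not> v_adj E v b \<or> a = b \<or> v_adj E a b) \<and>
     (\<forall>x\<in>set (elems U). \<not> (\<exists>e\<in>set (elems E). joins e v x \<and> vsnd (vsnd e) \<noteq> Atom 0) \<or>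
        length (filter (\<lambda>z. v_outer E v x z) (elems U)) <
        length (filter (\<lambda>u. v_same E U v x u) (elems U)))"

definition v_remove :: "val \<Rightarrow> val \<Rightarrow> val" where
  "v_remove y U = enc_list (filter (\<lambda>u. u \<noteq> y) (elems U))"

text \<open>Each test refers to the current set \<open>W\<close>. A deletion can shrink
  \<open>outer\<close> for a vertex tested earlier and make it deletable, so one pass may not
  suffice.\<close>

definition v_pass :: "val \<Rightarrow> val \<Rightarrow> val" where
  "v_pass E U = foldr (\<lambda>y W. if v_deletable E W y then v_remove y W else W) (elems U) U"

text \<open>
  The elements of \<open>V\<close> serve only as a clock here: a pass without effect means that no vertex is
  deletable, and there can be at most as many other passes as vertices.
\<close>

definition v_kernel :: "val \<Rightarrow> val \<Rightarrow> val" where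
  "v_kernel E V = foldr (\<lambda>_ U. v_pass E U) (elems V) V"

definition v_kept :: "val \<Rightarrow> val \<Rightarrow> bool" where
  "v_kept U e \<longleftrightarrow> (\<exists>u\<in>set (elems U). u = vfst e) \<and> (\<exists>u\<in>set (elems U). u = vfst (vsnd e))"

text \<open>Integers are stored as sign and absolute value, and machine subtraction truncates at 0,
  hence the case distinction. The strict comparison gives the result 0 a nonnegative sign, as in
  \<open>enc_int\<close>.\<close>

definition v_minus :: "val \<Rightarrow> nat \<Rightarrow> val" where
  "v_minus b n =
     (if vfst b = Atom 0 then
        if num (vsnd b) < n then Node (Atom 1) (Atom (n - num (vsnd b)))
        else Node (Atom 0) (Atom (num (vsnd b) - n))
      else Node (Atom 1) (Atom (num (vsnd b) + n)))"

definition v_restrict :: "val \<Rightarrow> val \<Rightarrow> val" where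
  "v_restrict U I = Node U (Node (enc_list (filter (\<lambda>e. v_kept U e) (elems (vfst (vsnd I)))))
     (Node (vfst (vsnd (vsnd I)))
       (v_minus (vsnd (vsnd (vsnd I)))
         (length (filter (\<lambda>e. \<not> v_kept U e \<and> vsnd (vsnd e) = Atom 0) (elems (vfst (vsnd I))))))))"

section \<open>Running time of the algorithm\<close>

text \<open>Deletion enlarges no tree, well-formed or not; this gives the growth hypothesis of
  \<open>ptime_foldr\<close> for both nested loops.\<close>

lemma val_size_remove: "val_size (v_remove y U) \<le> val_size U"
  unfolding v_remove_def by (rule val_size_enc_list_filter)

lemma val_size_pass: "val_size (v_pass E U) \<le> val_size U"
proof -
  have "val_size (foldr (\<lambda>y W. if v_deletable E W y then v_remove y W else W) ys U) \<le> val_size U" for ys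
    by (induction ys) (auto intro: order_trans[OF val_size_remove])
  then show ?thesis unfolding v_pass_def .
qed

lemma ptime_deletable:
  assumes "ptime E" "ptime U" "ptime v"
  shows "ptime_pred (\<lambda>x. v_deletable (E x) (U x) (v x))"
proof -
  \<comment> \<open>\<open>ptime\<close> is a notion for unary functions. The claim is shown for the
    components of one triple and then composed with the pairing of the actual arguments.\<close>
  have "ptime_pred (\<lambda>z. v_deletable (vfst z) (vfst (vsnd z)) (vsnd (vsnd z)))"
    unfolding v_deletable_def v_same_def v_outer_def v_adj_def joins_def
    by (intro ptime_intros)
  from ptime_comp[OF this, of "\<lambda>x. Node (E x) (Node (U x) (v x))"] assms
  show ?thesis by (simp add: ptime_Node)
qed

lemma ptime_pass:
  assumes "ptime E" "ptime U"
  shows "ptime (\<lambda>x. v_pass (E x) (U x))"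
proof -
  have growth: "val_size (if v_deletable E W y then v_remove y W else W) \<le> val_size W + val_size y + 2"
    for E W y
    using val_size_remove[of y W] by auto
  have remove: "ptime (\<lambda>z. v_remove (vfst (vsnd z)) (vsnd (vsnd z)))"
    unfolding v_remove_def by (intro ptime_intros)
  have "ptime (\<lambda>z. v_pass (vfst z) (vsnd z))"
    unfolding v_pass_def
    by (intro ptime_foldr growth ptime_if ptime_deletable remove ptime_id ptime_apply1)
  from ptime_comp[OF this, of "\<lambda>x. Node (E x) (U x)"] assms show ?thesis by (simp add: ptime_Node)
qed

lemma ptime_kernel: "ptime (\<lambda>I. v_restrict (v_kernel (vfst (vsnd I)) (vfst I)) I)"
proof -
  have growth: "val_size (v_pass E W) \<le> val_size W + val_size y + 2" for E W y
    using val_size_pass[of E W] by simp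
  have kernel: "ptime (\<lambda>I. v_kernel (vfst (vsnd I)) (vfst I))"
    unfolding v_kernel_def
    by (intro ptime_foldr growth ptime_pass ptime_intros)
  have "ptime (\<lambda>z. v_restrict (vfst z) (vsnd z))"
    unfolding v_restrict_def v_minus_def v_kept_def by (intro ptime_intros)
  from ptime_comp[OF this ptime_Node[OF kernel ptime_id]] show ?thesis by simp
qed

section \<open>Correctness of the algorithm on encodings\<close>

definition enc_edge :: "el_instance \<Rightarrow> nat \<times> nat \<Rightarrow> val" where
  "enc_edge I = (\<lambda>(u, v). Node (Atom u) (Node (Atom v) (enc_set (edge_lists I {u, v}))))"

definition enc_edges :: "el_instance \<Rightarrow> val" where
  "enc_edges I = enc_list (map (enc_edge I) (edge_list I))"

lemma encode_eq: "encode I = Node (enc_set (verts I)) (Node (enc_edges I)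
    (Node (Atom (colors I)) (enc_int (budget I))))"
  unfolding encode_def enc_edges_def enc_edge_def ..

lemma elems_enc_set [simp]: "elems (enc_set U) = map Atom (sorted_list_of_set U)"
  unfolding enc_set_def by simp

text \<open>Increasing order makes the encoding canonical, so the algorithm may compare colour lists
  as trees.\<close>

lemma enc_set_eq_iff: "finite A \<Longrightarrow> finite B \<Longrightarrow> enc_set A = enc_set B \<longleftrightarrow> A = B"
  by (metis elems_enc_set inj_map_eq_map injI set_sorted_list_of_set val.inject(1))

lemma enc_set_eq_Atom_iff: "finite A \<Longrightarrow> enc_set A = Atom 0 \<longleftrightarrow> A = {}"
  using enc_set_eq_iff[of A "{}"] by (simp add: enc_set_def)

lemma length_filter_enc_set:
  assumes "finite U"
  shows "length (filter Q (elems (enc_set U))) = card {u \<in> U. Q (Atom u)}"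
  using assms by (simp add: filter_map o_def distinct_length_filter Int_def conj_commute)

lemma set_edge_list:
  assumes "wf_instance I"
  shows "set (edge_list I) = {(u, v). u < v \<and> {u, v} \<in> edges I}"
proof -
  have "u \<in> verts I \<and> v \<in> verts I" if "{u, v} \<in> edges I" for u v
    using assms that unfolding wf_instance_def nsets_def by auto
  moreover have "finite (verts I)" using assms unfolding wf_instance_def by auto
  ultimately show ?thesis unfolding edge_list_def by auto
qed

text \<open>An edge is stored once, smaller end first, whereas \<open>joins\<close> accepts both
  orders. The free predicate \<open>Q\<close> lets one lemma serve for adjacency, nonempty lists and
  equality of lists.\<close>

lemma bex_joins:
  assumes "wf_instance I"
  shows "(\<exists>e\<in>set (elems (enc_edges I)). joins e (Atom u) (Atom v) \<and> Q (vsnd (vsnd e))) \<longleftrightarrow>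
    {u, v} \<in> edges I \<and> Q (enc_set (edge_lists I {u, v}))"
proof -
  have "u \<noteq> v" if "{u, v} \<in> edges I" using wf_card_edge[OF assms that] by auto
  then show ?thesis
    unfolding enc_edges_def joins_def enc_edge_def
    by (cases u v rule: linorder_cases)
      (auto simp: set_edge_list[OF assms]; metis insert_commute)+
qed

lemma v_adj_iff:
  assumes "wf_instance I"
  shows "v_adj (enc_edges I) (Atom u) (Atom v) \<longleftrightarrow> {u, v} \<in> edges I"
  using bex_joins[OF assms, of u v "\<lambda>_. True"] unfolding v_adj_def by simp

lemma v_deletable_iff:
  assumes wf: "wf_instance I" and U: "U \<subseteq> verts I" and v: "v \<in> U"
  shows "v_deletable (enc_edges I) (enc_set U) (Atom v) \<longleftrightarrow>
    deletable (induced I U) (edge_lists I) v"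
proof -
  have fin: "finite U" using wf U unfolding wf_instance_def by (auto intro: finite_subset)
  have ind: "{a, b} \<in> induced I U \<longleftrightarrow> a \<in> U \<and> b \<in> U \<and> {a, b} \<in> edges I" for a b
    unfolding induced_def by auto
  note adj = v_adj_iff[OF wf]
  have outer: "{z \<in> U. v_outer (enc_edges I) (Atom v) (Atom x) (Atom z)} = outer (induced I U) v x"
    if "x \<in> U" for x
    using that v unfolding v_outer_def adj outer_def ind by auto
  have same: "{u \<in> U. v_same (enc_edges I) (enc_set U) (Atom v) (Atom x) (Atom u)} =
      same (induced I U) (edge_lists I) v x" if x: "x \<in> U" "{v, x} \<in> edges I" for x
  proof -
    have core: "(\<exists>z\<in>set (elems (enc_set U)). v_outer (enc_edges I) (Atom v) (Atom u) z)
        \<longleftrightarrow> outer (induced I U) v u \<noteq> {}" if "u \<in> U" for u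
      using outer[OF that] fin by auto
    have inner: "(\<exists>e'\<in>set (elems (enc_edges I)). joins e' (Atom v) (Atom x) \<and> l = vsnd (vsnd e'))
        \<longleftrightarrow> l = enc_set (edge_lists I {v, x})" for l
      using bex_joins[OF wf, of v x "\<lambda>l'. l = l'"] x(2) by simp
    have list: "(\<exists>e\<in>set (elems (enc_edges I)). joins e (Atom x) (Atom u) \<and>
        (\<exists>e'\<in>set (elems (enc_edges I)). joins e' (Atom v) (Atom x) \<and> vsnd (vsnd e) = vsnd (vsnd e')))
      \<longleftrightarrow> {x, u} \<in> edges I \<and> edge_lists I {x, u} = edge_lists I {v, x}" for u
      unfolding inner bex_joins[OF wf, where Q = "\<lambda>l. l = enc_set (edge_lists I {v, x})"]
      using enc_set_eq_iff[OF wf_finite_list[OF wf] wf_finite_list[OF wf x(2)]] by blast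
    have "v_same (enc_edges I) (enc_set U) (Atom v) (Atom x) (Atom u) \<longleftrightarrow>
        (u = v \<or> {v, u} \<in> edges I) \<and> outer (induced I U) v u = {} \<and>
        {x, u} \<in> edges I \<and> edge_lists I {x, u} = edge_lists I {v, x}" if "u \<in> U" for u
      unfolding v_same_def adj core[OF that] list by simp
    then show ?thesis using x v unfolding same_def core_def ind by auto
  qed
  have nonempty: "(\<exists>e\<in>set (elems (enc_edges I)). joins e (Atom v) (Atom x) \<and> vsnd (vsnd e) \<noteq> Atom 0)
      \<longleftrightarrow> {v, x} \<in> edges I \<and> edge_lists I {v, x} \<noteq> {}" for x
    unfolding bex_joins[OF wf, where Q = "\<lambda>l. l \<noteq> Atom 0"]
    using enc_set_eq_Atom_iff wf_finite_list[OF wf] by auto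
  have set: "set (elems (enc_set U)) = Atom ` U" using fin by simp
  have "v_deletable (enc_edges I) (enc_set U) (Atom v) \<longleftrightarrow>
     (\<forall>a\<in>U. \<forall>b\<in>U. {v, a} \<notin> edges I \<or> {v, b} \<notin> edges I \<or> a = b \<or> {a, b} \<in> edges I) \<and>
     (\<forall>x\<in>U. \<not> ({v, x} \<in> edges I \<and> edge_lists I {v, x} \<noteq> {}) \<or>
        card {z \<in> U. v_outer (enc_edges I) (Atom v) (Atom x) (Atom z)} <
        card {u \<in> U. v_same (enc_edges I) (enc_set U) (Atom v) (Atom x) (Atom u)})"
    unfolding v_deletable_def length_filter_enc_set[OF fin] set ball_simps(9) nonempty adj by simp
  also have "\<dots> \<longleftrightarrow>
     (\<forall>a\<in>U. \<forall>b\<in>U. {v, a} \<notin> edges I \<or> {v, b} \<notin> edges I \<or> a = b \<or> {a, b} \<in> edges I) \<and>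
     (\<forall>x\<in>U. \<not> ({v, x} \<in> edges I \<and> edge_lists I {v, x} \<noteq> {}) \<or>
        card (outer (induced I U) v x) < card (same (induced I U) (edge_lists I) v x))"
    by (intro conj_cong ball_cong refl) (use outer same in auto)
  also have "\<dots> \<longleftrightarrow> deletable (induced I U) (edge_lists I) v"
    using v unfolding deletable_def simplicial_def ind by auto
  finally show ?thesis .
qed

lemma v_remove_enc_set:
  assumes "finite U"
  shows "v_remove (Atom y) (enc_set U) = enc_set (U - {y})"
proof -
  have "sorted_list_of_set (U - {y}) = filter (\<lambda>u. u \<noteq> y) (sorted_list_of_set U)"
    using assms by (simp add: sorted_list_of_set_remove distinct_remove1_removeAll
        removeAll_filter_not_eq eq_commute[of y])
  then show ?thesis unfolding v_remove_def by (simp add: enc_set_def filter_map o_def)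
qed

text \<open>Deleted vertices never return, so a pass that ends with \<open>U\<close> has made all
  its tests against \<open>U\<close> itself and certifies that none of the tested vertices is
  deletable.\<close>

lemma v_pass_loop:
  assumes wf: "wf_instance I" and U: "U \<subseteq> verts I"
  shows "\<exists>U'. foldr (\<lambda>y W. if v_deletable (enc_edges I) W y then v_remove y W else W)
      (map Atom ys) (enc_set U) = enc_set U' \<and> (step I)\<^sup>*\<^sup>* U U' \<and>
    (U' = U \<longrightarrow> (\<forall>y\<in>set ys. y \<in> U \<longrightarrow> \<not> deletable (induced I U) (edge_lists I) y))"
proof (induction ys)
  case (Cons y ys)
  then obtain U' where U': "foldr (\<lambda>y W. if v_deletable (enc_edges I) W y then v_remove y W else W)
      (map Atom ys) (enc_set U) = enc_set U'" "(step I)\<^sup>*\<^sup>* U U'"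
    "U' = U \<longrightarrow> (\<forall>y\<in>set ys. y \<in> U \<longrightarrow> \<not> deletable (induced I U) (edge_lists I) y)" by blast
  have sub: "U' \<subseteq> U" by (rule steps_subset[OF U'(2)])
  then have fin: "finite U'" using wf U unfolding wf_instance_def by (auto intro: finite_subset)
  show ?case
  proof (cases "y \<in> U' \<and> deletable (induced I U') (edge_lists I) y")
    case True
    then have "v_deletable (enc_edges I) (enc_set U') (Atom y)"
      using v_deletable_iff[OF wf] sub U by auto
    moreover have "(step I)\<^sup>*\<^sup>* U (U' - {y})"
      using U'(2) by (rule rtranclp.rtrancl_into_rtrancl) (use True in \<open>auto simp: step_def\<close>)
    moreover have "U' - {y} \<noteq> U" using True sub by auto
    ultimately show ?thesis using U'(1) v_remove_enc_set[OF fin] by auto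
  next
    case False
    \<comment> \<open>For \<open>y\<close> outside \<open>U'\<close> the outcome of the test is not
      controlled, but then the removal has no effect.\<close>
    have "(if v_deletable (enc_edges I) (enc_set U') (Atom y) then v_remove (Atom y) (enc_set U')
        else enc_set U') = enc_set U'"
    proof (cases "y \<in> U'")
      case True
      then show ?thesis using False v_deletable_iff[OF wf _ True] sub U by auto
    qed (simp add: v_remove_enc_set[OF fin])
    then show ?thesis using U' False by auto
  qed
qed auto

text \<open>Invariant: either no vertex is deletable, or every pass so far has removed a vertex.
  After as many passes as there are vertices the second alternative leaves the empty set, where
  nothing is deletable either.\<close>

lemma v_kernel_enc:
  assumes wf: "wf_instance I"
  shows "\<exists>U. v_kernel (enc_edges I) (enc_set (verts I)) = enc_set U \<and> (step I)\<^sup>*\<^sup>* (verts I) U \<and>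
    (\<forall>v\<in>U. \<not> deletable (induced I U) (edge_lists I) v)"
proof -
  let ?V = "verts I"
  have fin: "finite ?V" using wf unfolding wf_instance_def by auto
  have "\<exists>U. foldr (\<lambda>_ U. v_pass (enc_edges I) U) zs (enc_set ?V) = enc_set U \<and> (step I)\<^sup>*\<^sup>* ?V U \<and>
    ((\<forall>v\<in>U. \<not> deletable (induced I U) (edge_lists I) v) \<or> card U + length zs \<le> card ?V)"
    for zs :: "val list"
  proof (induction zs)
    case (Cons z zs)
    then obtain U where U: "foldr (\<lambda>_ U. v_pass (enc_edges I) U) zs (enc_set ?V) = enc_set U"
      "(step I)\<^sup>*\<^sup>* ?V U"
      "(\<forall>v\<in>U. \<not> deletable (induced I U) (edge_lists I) v) \<or> card U + length zs \<le> card ?V"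
      by blast
    have sub: "U \<subseteq> ?V" by (rule steps_subset[OF U(2)])
    have finU: "finite U" using sub fin by (rule finite_subset)
    obtain U' where U': "v_pass (enc_edges I) (enc_set U) = enc_set U'" "(step I)\<^sup>*\<^sup>* U U'"
      "U' = U \<longrightarrow> (\<forall>y\<in>U. \<not> deletable (induced I U) (edge_lists I) y)"
      using v_pass_loop[OF wf sub, of "sorted_list_of_set U"] finU unfolding v_pass_def by auto
    have "(\<forall>v\<in>U'. \<not> deletable (induced I U') (edge_lists I) v) \<or> card U' + Suc (length zs) \<le> card ?V"
    proof (cases "U' = U")
      case False
      \<comment> \<open>A pass with effect shows that \<open>U\<close> had a deletable vertex, so
        before this pass the second alternative of the invariant held.\<close>
      from U'(2) have "\<exists>U1. step I U U1"
        by (cases rule: converse_rtranclpE) (use False in auto)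
      then obtain U1 where "step I U U1" ..
      then have "card U + length zs \<le> card ?V" using U(3) unfolding step_def by blast
      moreover have "card U' < card U"
        using False steps_subset[OF U'(2)] finU by (intro psubset_card_mono) auto
      ultimately show ?thesis by simp
    qed (use U'(3) in simp)
    moreover have "(step I)\<^sup>*\<^sup>* ?V U'" using U(2) U'(2) by (rule rtranclp_trans)
    ultimately show ?case using U(1) U'(1) by auto
  qed auto
  from this[of "elems (enc_set ?V)"] obtain U where
    U: "v_kernel (enc_edges I) (enc_set ?V) = enc_set U" "(step I)\<^sup>*\<^sup>* ?V U"
    "(\<forall>v\<in>U. \<not> deletable (induced I U) (edge_lists I) v) \<or> card U + card ?V \<le> card ?V"
    unfolding v_kernel_def by auto
  moreover have "finite U" using steps_subset[OF U(2)] fin by (rule finite_subset)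
  ultimately show ?thesis by auto
qed

lemma v_minus_enc_int: "v_minus (enc_int k) n = enc_int (k - int n)"
  unfolding v_minus_def enc_int_def by (auto simp: nat_diff_distrib)

text \<open>The output must be literally the encoding of the smaller instance, order included.
  Filtering a sorted list keeps it sorted, hence it commutes with the enumeration of pairs.\<close>

lemma edge_list_subinstance:
  assumes wf: "wf_instance I" and U: "U \<subseteq> verts I"
  shows "edge_list (subinstance I U) = filter (\<lambda>(u, v). u \<in> U \<and> v \<in> U) (edge_list I)"
proof -
  have fin: "finite (verts I)" using wf unfolding wf_instance_def by auto
  have L: "sorted_list_of_set U = filter (\<lambda>u. u \<in> U) (sorted_list_of_set (verts I))"
    using fin U finite_subset[OF U fin]
    by (intro sorted_distinct_set_unique) (auto simp: sorted_wrt_filter)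
  have inner: "filter (\<lambda>(u, v). u \<in> U \<and> v \<in> U)
       (concat (map (\<lambda>v. if u < v \<and> {u, v} \<in> edges I then [(u, v)] else []) ys)) =
     (if u \<in> U then concat (map (\<lambda>v. if u < v \<and> {u, v} \<in> induced I U then [(u, v)] else [])
       (filter (\<lambda>u. u \<in> U) ys)) else [])" for u ys
    by (induction ys) (auto simp: induced_def)
  have "filter (\<lambda>(u, v). u \<in> U \<and> v \<in> U)
       (concat (map (\<lambda>u. concat (map (\<lambda>v. if u < v \<and> {u, v} \<in> edges I then [(u, v)] else []) ys)) xs)) =
     concat (map (\<lambda>u. concat (map (\<lambda>v. if u < v \<and> {u, v} \<in> induced I U then [(u, v)] else [])
       (filter (\<lambda>u. u \<in> U) ys))) (filter (\<lambda>u. u \<in> U) xs))" for xs ys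
    by (induction xs) (auto simp: inner)
  then show ?thesis unfolding edge_list_def subinstance_def by (simp add: L)
qed

lemma distinct_edge_list: "distinct (edge_list I)"
proof -
  have "edge_list I = filter (\<lambda>(u, v). u < v \<and> {u, v} \<in> edges I)
     (List.product (sorted_list_of_set (verts I)) (sorted_list_of_set (verts I)))"
  proof -
    have inner: "concat (map (\<lambda>v. if u < v \<and> {u, v} \<in> edges I then [(u, v)] else []) ys) =
        filter (\<lambda>(u, v). u < v \<and> {u, v} \<in> edges I) (map (Pair u) ys)" for u ys
      by (induction ys) auto
    have "concat (map (\<lambda>u. concat (map (\<lambda>v. if u < v \<and> {u, v} \<in> edges I then [(u, v)] else []) ys)) xs) =
        filter (\<lambda>(u, v). u < v \<and> {u, v} \<in> edges I) (List.product xs ys)" for xs ys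
      by (induction xs) (auto simp: inner)
    then show ?thesis unfolding edge_list_def by simp
  qed
  then show ?thesis by (simp add: distinct_product)
qed

lemma v_restrict_encode:
  assumes wf: "wf_instance I" and U: "U \<subseteq> verts I"
  shows "v_restrict (enc_set U) (encode I) = encode (subinstance I U)"
proof -
  have fin: "finite U" using wf U unfolding wf_instance_def by (auto intro: finite_subset)
  have kept: "v_kept (enc_set U) (enc_edge I (u, v)) \<longleftrightarrow> u \<in> U \<and> v \<in> U" for u v
    using fin unfolding v_kept_def enc_edge_def by auto
  have "filter (v_kept (enc_set U)) (elems (enc_edges I)) = map (enc_edge I) (edge_list (subinstance I U))"
    unfolding enc_edges_def edge_list_subinstance[OF assms]
    by (simp add: filter_map o_def kept split_def)
      (metis (no_types, lifting) kept prod.collapse)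
  moreover have "map (enc_edge I) (edge_list (subinstance I U)) =
      map (enc_edge (subinstance I U)) (edge_list (subinstance I U))"
    unfolding enc_edge_def subinstance_def by simp
  ultimately have edges: "enc_list (filter (v_kept (enc_set U)) (elems (enc_edges I))) =
      enc_edges (subinstance I U)" unfolding enc_edges_def by simp
  have "length (filter (\<lambda>e. \<not> v_kept (enc_set U) e \<and> vsnd (vsnd e) = Atom 0) (elems (enc_edges I))) =
     length (filter (\<lambda>p. \<not> v_kept (enc_set U) (enc_edge I p) \<and> vsnd (vsnd (enc_edge I p)) = Atom 0)
       (edge_list I))"
    unfolding enc_edges_def by (simp add: filter_map o_def)
  also have "\<dots> = card {p \<in> set (edge_list I). \<not> v_kept (enc_set U) (enc_edge I p) \<and>
      vsnd (vsnd (enc_edge I p)) = Atom 0}"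
    using distinct_edge_list by (simp flip: set_filter distinct_card)
  also have "\<dots> = card {e \<in> edges I. \<not> e \<subseteq> U \<and> edge_lists I e = {}}"
  \<comment> \<open>The algorithm counts stored pairs, the budget counts edges; each edge has
    exactly one representation with \<open>u < v\<close>.\<close>
  proof (rule bij_betw_same_card[of "\<lambda>(u, v). {u, v}"])
    have list: "vsnd (vsnd (enc_edge I (u, v))) = Atom 0 \<longleftrightarrow> edge_lists I {u, v} = {}"
      if "{u, v} \<in> edges I" for u v
      using enc_set_eq_Atom_iff[OF wf_finite_list[OF wf that]] unfolding enc_edge_def by simp
    have pair: "\<exists>u v. u < v \<and> e = {u, v}" if e: "e \<in> edges I" for e
    proof -
      obtain a b where "e = {a, b}" "a \<noteq> b" using wf_card_edge[OF wf e] by (meson card_2_iff)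
      then show ?thesis by (metis insert_commute linorder_neqE_nat)
    qed
    have L: "{p \<in> set (edge_list I). \<not> v_kept (enc_set U) (enc_edge I p) \<and>
        vsnd (vsnd (enc_edge I p)) = Atom 0} =
      {(u, v). u < v \<and> {u, v} \<in> edges I \<and> \<not> {u, v} \<subseteq> U \<and> edge_lists I {u, v} = {}}"
      unfolding set_edge_list[OF wf] using list kept by auto
    show "bij_betw (\<lambda>(u, v). {u, v})
       {p \<in> set (edge_list I). \<not> v_kept (enc_set U) (enc_edge I p) \<and> vsnd (vsnd (enc_edge I p)) = Atom 0}
       {e \<in> edges I. \<not> e \<subseteq> U \<and> edge_lists I e = {}}"
      unfolding L
    proof (rule bij_betw_imageI)
      show "inj_on (\<lambda>(u, v). {u, v})
         {(u, v). u < v \<and> {u, v} \<in> edges I \<and> \<not> {u, v} \<subseteq> U \<and> edge_lists I {u, v} = {}}"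
        by (auto simp: inj_on_def doubleton_eq_iff)
      show "(\<lambda>(u, v). {u, v}) `
         {(u, v). u < v \<and> {u, v} \<in> edges I \<and> \<not> {u, v} \<subseteq> U \<and> edge_lists I {u, v} = {}} =
         {e \<in> edges I. \<not> e \<subseteq> U \<and> edge_lists I e = {}}"
      proof (intro equalityI subsetI)
        fix e assume e: "e \<in> {e \<in> edges I. \<not> e \<subseteq> U \<and> edge_lists I e = {}}"
        then obtain u v where "u < v" "e = {u, v}" using pair[of e] by blast
        then show "e \<in> (\<lambda>(u, v). {u, v}) `
          {(u, v). u < v \<and> {u, v} \<in> edges I \<and> \<not> {u, v} \<subseteq> U \<and> edge_lists I {u, v} = {}}"
          using e by (intro image_eqI[of _ _ "(u, v)"]) simp_all
      qed auto
    qed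
  qed
  finally show ?thesis
    unfolding v_restrict_def encode_eq
    by (simp add: edges v_minus_enc_int) (simp add: subinstance_def)
qed

theorem theorem6:
  "\<exists>(P :: program) (p :: nat poly). \<forall>I. wf_instance I \<longrightarrow>
     (\<exists>J t. runs P (encode I) (encode J) t \<and> t \<le> poly p (val_size (encode I)) \<and>
            wf_instance J \<and>
            (el_multi_stc J \<longleftrightarrow> el_multi_stc I) \<and>
            card (verts J) \<le> (tau I + 1) * (2 * k1 (edges I)))"
proof -
  obtain P p where run: "\<And>x. \<exists>t\<le>poly p (val_size x).
      runs P x (v_restrict (v_kernel (vfst (vsnd x)) (vfst x)) x) t"
    using ptime_runs[OF ptime_kernel] by blast
  have "\<exists>J t. runs P (encode I) (encode J) t \<and> t \<le> poly p (val_size (encode I)) \<and>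
            wf_instance J \<and> (el_multi_stc J \<longleftrightarrow> el_multi_stc I) \<and>
            card (verts J) \<le> (tau I + 1) * (2 * k1 (edges I))"
    if wf: "wf_instance I" for I
  proof -
    obtain U where U: "v_kernel (enc_edges I) (enc_set (verts I)) = enc_set U"
      "(step I)\<^sup>*\<^sup>* (verts I) U" "\<forall>v\<in>U. \<not> deletable (induced I U) (edge_lists I) v"
      using v_kernel_enc[OF wf] by blast
    have sub: "U \<subseteq> verts I" by (rule steps_subset[OF U(2)])
    have "v_restrict (v_kernel (vfst (vsnd (encode I))) (vfst (encode I))) (encode I) =
        encode (subinstance I U)"
      using U(1) v_restrict_encode[OF wf sub] by (simp add: encode_eq)
    moreover have "card (verts (subinstance I U)) \<le> (tau I + 1) * (2 * k1 (edges I))"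
      using subinstance_bound[OF wf sub U(3)] by (simp add: subinstance_def)
    ultimately show ?thesis
      using run[of "encode I"] wf_subinstance[OF wf sub] steps_equivalent[OF wf U(2)]
        subinstance_verts[OF wf] by auto
  qed
  then show ?thesis by blast
qed

end
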